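(* There exist a constant $q>0$ and an instance such that, for any service slack $\epsilon\le q/\sqrt T$, the regret of the CO-DL algorithm (described in the context, with learning rates $\eta_t=k/\sqrt t$ for a constant $k>0$) is $\Omega(\gamma\sqrt T)$.
   Context: Problem. There are $m$ affiliates and $T$ periods; one case per period $t$. Case $t$ has type $\mathbf A_t=(\mathbf w_t,i^\dagger_t)$, $\mathbf w_t\in[0,1]^m$, $i^\dagger_t\in\{0,\dots,m\}$ ($0$: free; $i\in[m]$: tied to affiliate $i$). Types i.i.d. from a distribution $\mathcal F$. $\Delta_m=\{\mathbf z\in\mathbb R^m_+:\sum_iz_i\le1\}$, $\mathcal Z(0)=\Delta_m$, $\mathcal Z(i)=\{\mathbf e_i\}$. Capacities $c_i$, $\rho_i=c_i/T$, $\underline\rho=\min_i\rho_i$, $\sum_i\rho_i\le1$, constant $d>0$ with $\rho_i-\Pr[i^\dagger_t=i]\ge d$. Service $s_{t,i}\sim\mathrm{Bernoulli}(r_i)$ i.i.d. over $t$, independent of arrivals, $r_i\in(0,1)$, $r_i\ge\rho_i+\epsilon$ with service slack $\epsilon\ge0$. Backlog $b_{0,i}=0$, $b_{t,i}=(b_{t-1,i}+z_{t,i}-s_{t,i})_+$. Penalties $\alpha,\gamma\ge0$; $\mathsf{ALG}^\pi(\alpha,\gamma)=\sum_{t,i}w_{t,i}z_{t,i}-\alpha\sum_i(\sum_tz_{t,i}-c_i)_+-\frac\gamma T\sum_{t,i}b_{t,i}$. $\mathsf{OPT}(\alpha,\gamma)$: per sample path, max of this expression over $\mathbf z_t\in\mathcal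 Z(i^\dagger_t)$, $\mathbf b_t\ge\mathbf0$ with $\sum_t\mathbb 1[i^\dagger_t=0]z_{t,i}\le(c_i-\sum_t\mathbb 1[i^\dagger_t=i]z_{t,i})_+$ and $b_{t,i}\ge b_{t-1,i}+z_{t,i}-s_{t,i}$, $b_{0,i}=0$. Regret on an instance: $\mathbb E[\mathsf{OPT}(\alpha,\gamma)-\mathsf{ALG}^\pi(\alpha,\gamma)]$. Asymptotics as $T\to\infty$; $\gamma$ may depend on $T$. CO-DL (inputs $T,\boldsymbol\rho,k$, $\eta_t=k/\sqrt t$): $\theta_{1,i}=\lambda_{1,i}=e^{-1}$, $c_{0,i}=\rho_iT$. For each $t$: if $i^\dagger_t\in[m]$, $\mathbf z_t=\mathbf e_{i^\dagger_t}$; else if $\min_ic_{t-1,i}>0$, $\mathbf z_t\in\arg\max_{\mathbf z\in\Delta_m\cap\{0,1\}^m}(\mathbf w_t-\boldsymbol\theta_t-\boldsymbol\lambda_t)\cdot\mathbf z$; else $\mathbf z_t=\mathbf0$. Update $c_{t,i}=c_{t-1,i}-z_{t,i}$, $\theta_{t+1,i}=\min\{\theta_{t,i}e^{\eta_t(z_{t,i}-\rho_i)},\alpha\}$, $\lambda_{t+1,i}=\min\{\lambda_{t,i}e^{\eta_t(z_{t,i}-\rho_i)},(1+2\alpha)/\underline\rho\}$. *)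

theory Defs
  imports "HOL-Probability.Probability"
begin

text \<open>
  Affiliates are the indices \<open>1, \<dots>, m\<close> and periods the indices \<open>1, \<dots>, T\<close>.  Vectors indexed by
  affiliates are functions \<open>nat \<Rightarrow> real\<close> (decision vectors vanish outside \<open>{1..m}\<close>).
  A case type is a pair of the reward vector and the tied affiliate, \<open>0\<close> meaning free.
\<close>

type_synonym case_type = "(nat \<Rightarrow> real) \<times> nat"

definition unit_vec :: "nat \<Rightarrow> nat \<Rightarrow> real" where
  "unit_vec i = (\<lambda>j. if j = i then 1 else 0)"

definition alloc_simplex :: "nat \<Rightarrow> (nat \<Rightarrow> real) set" where
  "alloc_simplex m = {z. (\<forall>i. 0 \<le> z i) \<and> (\<forall>i. i \<notin> {1..m} \<longrightarrow> z i = 0) \<and> (\<Sum>i=1..m. z i) \<le> 1}"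

definition feasible_alloc :: "nat \<Rightarrow> nat \<Rightarrow> (nat \<Rightarrow> real) set" where
  "feasible_alloc m i = (if i = 0 then alloc_simplex m else {unit_vec i})"

text \<open>
  Standing assumptions on the number of affiliates, the type distribution \<open>F\<close> and the capacity
  ratios \<open>\<rho>\<close>.  The sigma-algebra of \<open>F\<close> is arbitrary as long as the components of a type are
  measurable, so that discrete as well as Borel distributions are covered.
\<close>

definition valid_arrivals :: "nat \<Rightarrow> case_type measure \<Rightarrow> (nat \<Rightarrow> real) \<Rightarrow> bool" where
  "valid_arrivals m F \<rho> \<longleftrightarrow>
     1 \<le> m \<and> prob_space F \<and>
     (\<forall>i\<in>{1..m}. (\<lambda>a. fst a i) \<in> borel_measurable F) \<and>
     snd \<in> measurable F (count_space UNIV) \<and>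
     (AE a in F. (\<forall>i\<in>{1..m}. 0 \<le> fst a i \<and> fst a i \<le> 1) \<and> snd a \<le> m) \<and>
     (\<Sum>i=1..m. \<rho> i) \<le> 1 \<and>
     (\<exists>d>0. \<forall>i\<in>{1..m}. \<rho> i - measure F {a \<in> space F. snd a = i} \<ge> d)"

text \<open>
  A sample path consists of the arrivals \<open>a t\<close> and the service indicators \<open>s (t, i)\<close>; everything
  is drawn independently.
\<close>

definition sample_space ::
  "nat \<Rightarrow> nat \<Rightarrow> case_type measure \<Rightarrow> (nat \<Rightarrow> real) \<Rightarrow>
     ((nat \<Rightarrow> case_type) \<times> (nat \<times> nat \<Rightarrow> bool)) measure" where
  "sample_space m T F r =
     (\<Pi>\<^sub>M t\<in>{1..T}. F) \<Otimes>\<^sub>M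
     (\<Pi>\<^sub>M ti\<in>{1..T} \<times> {1..m}. measure_pmf (bernoulli_pmf (r (snd ti))))"

primrec backlog :: "(nat \<Rightarrow> nat \<Rightarrow> real) \<Rightarrow> (nat \<times> nat \<Rightarrow> bool) \<Rightarrow> nat \<Rightarrow> nat \<Rightarrow> real" where
  "backlog z s 0 i = 0"
| "backlog z s (Suc t) i = max 0 (backlog z s t i + z (Suc t) i - of_bool (s (Suc t, i)))"

definition objective ::
  "nat \<Rightarrow> nat \<Rightarrow> (nat \<Rightarrow> real) \<Rightarrow> real \<Rightarrow> real \<Rightarrow> (nat \<Rightarrow> case_type) \<Rightarrow>
     (nat \<Rightarrow> nat \<Rightarrow> real) \<Rightarrow> (nat \<Rightarrow> nat \<Rightarrow> real) \<Rightarrow> real" where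
  "objective m T c \<alpha> \<gamma> a z b =
     (\<Sum>t=1..T. \<Sum>i=1..m. fst (a t) i * z t i)
     - \<alpha> * (\<Sum>i=1..m. max 0 ((\<Sum>t=1..T. z t i) - c i))
     - \<gamma> / real T * (\<Sum>t=1..T. \<Sum>i=1..m. b t i)"

definition OPT_feasible ::
  "nat \<Rightarrow> nat \<Rightarrow> (nat \<Rightarrow> real) \<Rightarrow> (nat \<Rightarrow> case_type) \<Rightarrow> (nat \<times> nat \<Rightarrow> bool) \<Rightarrow>
     (nat \<Rightarrow> nat \<Rightarrow> real) \<Rightarrow> (nat \<Rightarrow> nat \<Rightarrow> real) \<Rightarrow> bool" where
  "OPT_feasible m T c a s z b \<longleftrightarrow>
     (\<forall>t\<in>{1..T}. z t \<in> feasible_alloc m (snd (a t))) \<and>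
     (\<forall>i\<in>{1..m}. (\<Sum>t=1..T. of_bool (snd (a t) = 0) * z t i)
        \<le> max 0 (c i - (\<Sum>t=1..T. of_bool (snd (a t) = i) * z t i))) \<and>
     (\<forall>i\<in>{1..m}. b 0 i = 0) \<and>
     (\<forall>t\<in>{1..T}. \<forall>i\<in>{1..m}. 0 \<le> b t i \<and> b (t - 1) i + z t i - of_bool (s (t, i)) \<le> b t i)"

definition OPT ::
  "nat \<Rightarrow> nat \<Rightarrow> (nat \<Rightarrow> real) \<Rightarrow> real \<Rightarrow> real \<Rightarrow> (nat \<Rightarrow> case_type) \<Rightarrow>
     (nat \<times> nat \<Rightarrow> bool) \<Rightarrow> real" where
  "OPT m T c \<alpha> \<gamma> a s = Sup {objective m T c \<alpha> \<gamma> a z b | z b. OPT_feasible m T c a s z b}"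

text \<open>
  The argmax in CO-DL need not be unique.  Ties are resolved by an arbitrary rule \<open>\<sigma>\<close> that returns,
  for period \<open>t\<close> and adjusted rewards \<open>v\<close>, some maximizer.
\<close>

definition argmax_rule :: "nat \<Rightarrow> (nat \<Rightarrow> (nat \<Rightarrow> real) \<Rightarrow> nat \<Rightarrow> real) \<Rightarrow> bool" where
  "argmax_rule m \<sigma> \<longleftrightarrow>
     (\<forall>t v. is_arg_max (\<lambda>z. \<Sum>i=1..m. v i * z i)
              (\<lambda>z. z \<in> alloc_simplex m \<and> (\<forall>i. z i \<in> {0, 1})) (\<sigma> t v))"

definition codl_decision ::
  "nat \<Rightarrow> (nat \<Rightarrow> (nat \<Rightarrow> real) \<Rightarrow> nat \<Rightarrow> real) \<Rightarrow> nat \<Rightarrow> case_type \<Rightarrow>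
     (nat \<Rightarrow> real) \<times> (nat \<Rightarrow> real) \<times> (nat \<Rightarrow> real) \<Rightarrow> nat \<Rightarrow> real" where
  "codl_decision m \<sigma> t x = (\<lambda>(c, \<theta>, \<mu>).
     if snd x \<noteq> 0 then unit_vec (snd x)
     else if Min (c ` {1..m}) > 0 then \<sigma> t (\<lambda>i. fst x i - \<theta> i - \<mu> i)
     else (\<lambda>_. 0))"

text \<open>
  The state with index \<open>t\<close> is the triple \<open>(c\<^sub>t, \<theta>\<^sub>t\<^sub>+\<^sub>1, \<mu>\<^sub>t\<^sub>+\<^sub>1)\<close>, where \<open>\<mu>\<close> is the dual variable
  usually written as lambda.
\<close>

primrec codl_state ::
  "nat \<Rightarrow> nat \<Rightarrow> (nat \<Rightarrow> real) \<Rightarrow> real \<Rightarrow> real \<Rightarrow> (nat \<Rightarrow> (nat \<Rightarrow> real) \<Rightarrow> nat \<Rightarrow> real) \<Rightarrow>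
     (nat \<Rightarrow> case_type) \<Rightarrow> nat \<Rightarrow> (nat \<Rightarrow> real) \<times> (nat \<Rightarrow> real) \<times> (nat \<Rightarrow> real)" where
  "codl_state m T \<rho> k \<alpha> \<sigma> a 0 = ((\<lambda>i. \<rho> i * real T), (\<lambda>_. exp (- 1)), (\<lambda>_. exp (- 1)))"
| "codl_state m T \<rho> k \<alpha> \<sigma> a (Suc t) =
     (let (c, \<theta>, \<mu>) = codl_state m T \<rho> k \<alpha> \<sigma> a t;
          z = codl_decision m \<sigma> (Suc t) (a (Suc t)) (c, \<theta>, \<mu>);
          \<eta> = k / sqrt (real (Suc t))
      in ((\<lambda>i. c i - z i),
          (\<lambda>i. min (\<theta> i * exp (\<eta> * (z i - \<rho> i))) \<alpha>),
          (\<lambda>i. min (\<mu> i * exp (\<eta> * (z i - \<rho> i))) ((1 + 2 * \<alpha>) / Min (\<rho> ` {1..m})))))"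

definition codl_alloc ::
  "nat \<Rightarrow> nat \<Rightarrow> (nat \<Rightarrow> real) \<Rightarrow> real \<Rightarrow> real \<Rightarrow> (nat \<Rightarrow> (nat \<Rightarrow> real) \<Rightarrow> nat \<Rightarrow> real) \<Rightarrow>
     (nat \<Rightarrow> case_type) \<Rightarrow> nat \<Rightarrow> nat \<Rightarrow> real" where
  "codl_alloc m T \<rho> k \<alpha> \<sigma> a t =
     codl_decision m \<sigma> t (a t) (codl_state m T \<rho> k \<alpha> \<sigma> a (t - 1))"

definition ALG_codl ::
  "nat \<Rightarrow> nat \<Rightarrow> (nat \<Rightarrow> real) \<Rightarrow> real \<Rightarrow> (nat \<Rightarrow> (nat \<Rightarrow> real) \<Rightarrow> nat \<Rightarrow> real) \<Rightarrow> real \<Rightarrow> real \<Rightarrow>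
     (nat \<Rightarrow> case_type) \<Rightarrow> (nat \<times> nat \<Rightarrow> bool) \<Rightarrow> real" where
  "ALG_codl m T \<rho> k \<sigma> \<alpha> \<gamma> a s =
     (let z = codl_alloc m T \<rho> k \<alpha> \<sigma> a
      in objective m T (\<lambda>i. \<rho> i * real T) \<alpha> \<gamma> a z (backlog z s))"

definition regret_codl ::
  "nat \<Rightarrow> case_type measure \<Rightarrow> (nat \<Rightarrow> real) \<Rightarrow> (nat \<Rightarrow> real) \<Rightarrow> nat \<Rightarrow> real \<Rightarrow>
     (nat \<Rightarrow> (nat \<Rightarrow> real) \<Rightarrow> nat \<Rightarrow> real) \<Rightarrow> real \<Rightarrow> real \<Rightarrow> real" where
  "regret_codl m F \<rho> r T k \<sigma> \<alpha> \<gamma> =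
     (\<integral>\<omega>. OPT m T (\<lambda>i. \<rho> i * real T) \<alpha> \<gamma> (fst \<omega>) (snd \<omega>)
          - ALG_codl m T \<rho> k \<sigma> \<alpha> \<gamma> (fst \<omega>) (snd \<omega>) \<partial>(sample_space m T F r))"

end

theory Submission
  imports Defs "HOL-Real_Asymp.Real_Asymp"
begin

text \<open>
  The instance has one affiliate with \<open>\<rho> = 1 / 2\<close> and two free types, of reward \<open>7 / 10\<close> with
  probability \<open>1 / 4\<close> (high) and of reward \<open>1 / 10\<close> otherwise (low).  The duals drive CO-DL to
  allocate, in expectation, at least \<open>t / 2 - o(\<surd>t)\<close> cases by time \<open>t\<close>.  Its decisions do not
  depend on the services, so its expected backlog at \<open>t\<close> is, up to a smaller error, at least that of
  the positive part of a centered random walk, which is of order \<open>\<surd>t\<close>.  The optimum may follow the services instead: it allocates the high cases, fills idle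
  service with low cases, and postpones the deficit of order \<open>\<surd>T\<close> to a short final window, which
  costs only a small multiple of \<open>\<gamma> \<surd>T\<close>.

  The bound has to hold for arbitrarily small \<open>\<gamma>\<close> as well.  CO-DL may exceed the capacity by less
  than one unit, a gain of at most \<open>1 / 10\<close> unless the high cases alone exceed the capacity; this
  is outweighed by the high case that it rejects in period \<open>1\<close> with probability \<open>1 / 4\<close>, because
  \<open>7 / 10 < 2 / e\<close>.
\<close>

text \<open>The level 1 / 10 is the fluid dual price: high cases use half of the capacity rate 1 /
  2, so low cases must be accepted part of the time and the price equals their reward. The obstacle
  is the constant: the allocation of CO-DL has to reach \<open>t / 2\<close> up to an error whose
  coefficient of sqrt t is smaller than that of the random walk, for every \<open>k\<close>; an
  error O(sqrt t) would prove nothing. Two facts about the logarithm of the dual sum give this.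
  Pathwise, while capacity remains and after a time depending on \<open>k\<close> only, it does not
  lie noticeably below the price. In expectation, its excess above the price, summed with weights 1
  / sqrt n, is only logarithmic. The surplus is thus controlled only in the mean, which suffices
  because the services are independent of it. All probability estimates are moment bounds up to
  order four, so that the constants are explicit and uniform in the slack.\<close>

section \<open>Finite probability spaces\<close>

text \<open>Every real function on such a space is measurable and integrable. This settles
  integrability at once for \<open>OPT\<close>, a supremum, and for CO-DL under an arbitrary
  tie-breaking rule.\<close>

definition finite_prob_space :: "'a measure \<Rightarrow> bool" where
  "finite_prob_space M \<longleftrightarrow> prob_space M \<and> finite (space M) \<and> sets M = Pow (space M)"

lemma finite_prob_space_measurable:
  fixes f :: "'a \<Rightarrow> real"
  assumes "finite_prob_space M"
  shows "f \<in> borel_measurable M"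
  using assms by (auto simp: finite_prob_space_def intro!: measurableI)

lemma finite_prob_space_integrable [simp]:
  fixes f :: "'a \<Rightarrow> real"
  assumes "finite_prob_space M"
  shows "integrable M f"
proof -
  interpret prob_space M using assms by (simp add: finite_prob_space_def)
  show ?thesis
  proof (rule integrable_const_bound)
    show "AE x in M. norm (f x) \<le> Max ((\<lambda>x. norm (f x)) ` space M)"
      using assms by (intro AE_I2 Max_ge) (auto simp: finite_prob_space_def)
  qed (rule finite_prob_space_measurable[OF assms])
qed

lemma finite_prob_space_PiM:
  assumes "finite I" "\<And>i. finite_prob_space (M i)"
  shows "finite_prob_space (PiM I M)"
  unfolding finite_prob_space_def
proof (intro conjI)
  show "prob_space (PiM I M)"
    using assms(2) by (intro prob_space_PiM) (auto simp: finite_prob_space_def)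
  show fin: "finite (space (PiM I M))"
    unfolding space_PiM using assms by (intro finite_PiE) (auto simp: finite_prob_space_def)
  show "sets (PiM I M) = Pow (space (PiM I M))"
  proof (intro antisym subsetI)
    fix A assume "A \<in> Pow (space (PiM I M))"
    then have A: "A \<subseteq> space (PiM I M)" by simp
    have "{x} \<in> sets (PiM I M)" if "x \<in> A" for x
    proof -
      have x: "x \<in> PiE I (\<lambda>i. space (M i))" using A that by (auto simp: space_PiM)
      have "PiE I (\<lambda>i. {x i}) \<in> sets (PiM I M)"
        using assms x by (intro sets_PiM_I_finite) (auto simp: finite_prob_space_def)
      moreover have "PiE I (\<lambda>i. {x i}) = {x}"
        using x by (metis PiE_singleton PiE_iff)
      ultimately show ?thesis by simp
    qed
    then have "(\<Union>x\<in>A. {x}) \<in> sets (PiM I M)"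
      using finite_subset[OF A fin] by (intro sets.finite_UN) auto
    then show "A \<in> sets (PiM I M)" by simp
  qed (auto dest: sets.sets_into_space)
qed

lemma finite_prob_space_pair:
  assumes "finite_prob_space M" "finite_prob_space N"
  shows "finite_prob_space (M \<Otimes>\<^sub>M N)"
  unfolding finite_prob_space_def
proof (intro conjI)
  interpret M: prob_space M using assms by (simp add: finite_prob_space_def)
  interpret N: prob_space N using assms by (simp add: finite_prob_space_def)
  interpret pair_prob_space M N ..
  show "prob_space (M \<Otimes>\<^sub>M N)" by (rule P.prob_space_axioms)
  show fin: "finite (space (M \<Otimes>\<^sub>M N))"
    unfolding space_pair_measure using assms by (auto simp: finite_prob_space_def)
  show "sets (M \<Otimes>\<^sub>M N) = Pow (space (M \<Otimes>\<^sub>M N))"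
  proof (intro antisym subsetI)
    fix A assume "A \<in> Pow (space (M \<Otimes>\<^sub>M N))"
    then have A: "A \<subseteq> space (M \<Otimes>\<^sub>M N)" by simp
    have "{x} \<in> sets (M \<Otimes>\<^sub>M N)" if "x \<in> A" for x
    proof -
      have "{fst x} \<times> {snd x} \<in> sets (M \<Otimes>\<^sub>M N)"
        using A assms that by (intro pair_measureI) (auto simp: finite_prob_space_def space_pair_measure)
      then show ?thesis by simp
    qed
    then have "(\<Union>x\<in>A. {x}) \<in> sets (M \<Otimes>\<^sub>M N)"
      using finite_subset[OF A fin] by (intro sets.finite_UN) auto
    then show "A \<in> sets (M \<Otimes>\<^sub>M N)" by simp
  qed (auto dest: sets.sets_into_space)
qed

lemma finite_prob_space_integral_pair:
  fixes f :: "'a \<times> 'b \<Rightarrow> real"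
  assumes "finite_prob_space M" "finite_prob_space N"
  shows "integral\<^sup>L (M \<Otimes>\<^sub>M N) f = (\<integral>x. \<integral>y. f (x, y) \<partial>N \<partial>M)"
    and "integral\<^sup>L (M \<Otimes>\<^sub>M N) f = (\<integral>y. \<integral>x. f (x, y) \<partial>M \<partial>N)"
proof -
  interpret M: prob_space M using assms by (simp add: finite_prob_space_def)
  interpret N: prob_space N using assms by (simp add: finite_prob_space_def)
  interpret pair_sigma_finite M N ..
  have int: "integrable (M \<Otimes>\<^sub>M N) f"
    by (intro finite_prob_space_integrable finite_prob_space_pair assms)
  show "integral\<^sup>L (M \<Otimes>\<^sub>M N) f = (\<integral>x. \<integral>y. f (x, y) \<partial>N \<partial>M)"
    using integral_fst'[OF int] by simp
  show "integral\<^sup>L (M \<Otimes>\<^sub>M N) f = (\<integral>y. \<integral>x. f (x, y) \<partial>M \<partial>N)"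
    using integral_snd[of "\<lambda>x y. f (x, y)"] int by simp
qed

text \<open>Independence of one coordinate from the others, by Fubini after splitting it off. That
  \<open>f\<close> ignores the coordinate is expressed by invariance under \<open>x(i := y)\<close>;
  for quantities that depend on the past only, this is immediate from their recursions and takes the
  place of a filtration.\<close>

lemma integral_PiM_mult_coord:
  fixes f :: "('i \<Rightarrow> 'a) \<Rightarrow> real" and g :: "'a \<Rightarrow> real"
  assumes I: "finite I" "i \<in> I" and M: "\<And>j. finite_prob_space (M j)"
    and f: "\<And>x y. x \<in> space (PiM I M) \<Longrightarrow> y \<in> space (M i) \<Longrightarrow> f (x(i := y)) = f x"
  shows "(\<integral>x. f x * g (x i) \<partial>PiM I M) = (\<integral>x. f x \<partial>PiM I M) * (\<integral>y. g y \<partial>M i)"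
proof -
  have prob: "prob_space (M j)" for j using M by (simp add: finite_prob_space_def)
  interpret product_sigma_finite M
    by standard (meson prob prob_space.axioms(1) finite_measure.axioms(1) sigma_finite_measure.sigma_finite_countable)
  interpret prob_space "M i" by (rule prob)
  define J where "J = I - {i}"
  have J: "I = insert i J" "finite J" "i \<notin> J" using I by (auto simp: J_def)
  obtain y0 where y0: "y0 \<in> space (M i)" using not_empty by blast
  have upd: "x(i := y) \<in> space (PiM I M)" if "x \<in> space (PiM J M)" "y \<in> space (M i)" for x y
    using that by (auto simp: space_PiM J(1) PiE_iff extensional_def)
  have const: "f (x(i := y)) = f (x(i := y0))" if "x \<in> space (PiM J M)" "y \<in> space (M i)" for x y
    using f[OF upd[OF that(1) y0] that(2)] by simp
  have int: "integrable (PiM I M) F" for F :: "_ \<Rightarrow> real"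
    by (intro finite_prob_space_integrable finite_prob_space_PiM I M)
  have "(\<integral>x. f x * g (x i) \<partial>PiM I M) = (\<integral>x. \<integral>y. f (x(i := y)) * g y \<partial>M i \<partial>PiM J M)"
    using product_integral_insert[OF J(2,3) int[unfolded J(1)], of "\<lambda>x. f x * g (x i)"] J(1) by simp
  also have "\<dots> = (\<integral>x. f (x(i := y0)) * (\<integral>y. g y \<partial>M i) \<partial>PiM J M)"
  proof (rule Bochner_Integration.integral_cong[OF refl])
    fix x assume x: "x \<in> space (PiM J M)"
    have "(\<integral>y. f (x(i := y)) * g y \<partial>M i) = (\<integral>y. f (x(i := y0)) * g y \<partial>M i)"
      by (rule Bochner_Integration.integral_cong[OF refl]) (simp add: const[OF x])
    then show "(\<integral>y. f (x(i := y)) * g y \<partial>M i) = f (x(i := y0)) * (\<integral>y. g y \<partial>M i)" by simp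
  qed
  also have "\<dots> = (\<integral>x. f (x(i := y0)) \<partial>PiM J M) * (\<integral>y. g y \<partial>M i)" by simp
  also have "(\<integral>x. f (x(i := y0)) \<partial>PiM J M) = (\<integral>x. \<integral>y. f (x(i := y)) \<partial>M i \<partial>PiM J M)"
  proof (rule Bochner_Integration.integral_cong[OF refl])
    fix x assume x: "x \<in> space (PiM J M)"
    have "(\<integral>y. f (x(i := y)) \<partial>M i) = (\<integral>y. f (x(i := y0)) \<partial>M i)"
      by (rule Bochner_Integration.integral_cong[OF refl]) (simp add: const[OF x])
    then show "f (x(i := y0)) = (\<integral>y. f (x(i := y)) \<partial>M i)" by (simp add: prob_space)
  qed
  also have "\<dots> = (\<integral>x. f x \<partial>PiM I M)"
    using product_integral_insert[OF J(2,3) int[unfolded J(1)], of f] J(1) by simp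
  finally show ?thesis .
qed

lemma integral_PiM_coord:
  fixes g :: "'a \<Rightarrow> real"
  assumes "finite I" "i \<in> I" "\<And>j. finite_prob_space (M j)"
  shows "(\<integral>x. g (x i) \<partial>PiM I M) = (\<integral>y. g y \<partial>M i)"
proof -
  interpret prob_space "PiM I M"
    using finite_prob_space_PiM[OF assms(1,3)] by (simp add: finite_prob_space_def)
  show ?thesis
    using integral_PiM_mult_coord[OF assms, where f = "\<lambda>_. 1" and g = g] by (simp add: prob_space)
qed

text \<open>An independent centered summand removes the cross terms in which it has exponent 1 or
  the earlier sum does, and 3 n^2 + 6 n + 3 = 3 (n + 1)^2 closes the induction for the fourth
  moment. The second and fourth moments together later bound a mean absolute value from below, in
  place of a central limit theorem.\<close>

lemma centered_sum_moments:
  fixes \<xi> :: "'i \<Rightarrow> 'a \<Rightarrow> real"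
  assumes I: "finite I" and M: "\<And>j. finite_prob_space (M j)" and J: "J \<subseteq> I"
    and mean: "\<And>i. i \<in> I \<Longrightarrow> (\<integral>y. \<xi> i y \<partial>M i) = 0"
    and var: "\<And>i. i \<in> I \<Longrightarrow> (\<integral>y. (\<xi> i y)\<^sup>2 \<partial>M i) = v"
    and bound: "\<And>i y. i \<in> I \<Longrightarrow> y \<in> space (M i) \<Longrightarrow> \<bar>\<xi> i y\<bar> \<le> 1"
  shows "(\<integral>x. (\<Sum>i\<in>J. \<xi> i (x i)) \<partial>PiM I M) = 0"
    and "(\<integral>x. (\<Sum>i\<in>J. \<xi> i (x i))\<^sup>2 \<partial>PiM I M) = real (card J) * v"
    and "(\<integral>x. (\<Sum>i\<in>J. \<xi> i (x i)) ^ 4 \<partial>PiM I M) \<le> 3 * (real (card J))\<^sup>2"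
proof -
  let ?P = "PiM I M"
  have int [simp]: "integrable ?P F" for F :: "_ \<Rightarrow> real"
    by (intro finite_prob_space_integrable finite_prob_space_PiM I M)
  have "finite J" using I J finite_subset by blast
  then have "(\<integral>x. (\<Sum>i\<in>J. \<xi> i (x i)) \<partial>?P) = 0 \<and>
    (\<integral>x. (\<Sum>i\<in>J. \<xi> i (x i))\<^sup>2 \<partial>?P) = real (card J) * v \<and>
    (\<integral>x. (\<Sum>i\<in>J. \<xi> i (x i)) ^ 4 \<partial>?P) \<le> 3 * (real (card J))\<^sup>2" using J
  proof (induction J rule: finite_induct)
    case empty
    then show ?case by simp
  next
    case (insert j J)
    let ?S = "\<lambda>x. \<Sum>i\<in>J. \<xi> i (x i)" and ?n = "real (card J)"
    have j: "j \<in> I" and IH: "(\<integral>x. ?S x \<partial>?P) = 0" "(\<integral>x. (?S x)\<^sup>2 \<partial>?P) = ?n * v"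
      "(\<integral>x. (?S x) ^ 4 \<partial>?P) \<le> 3 * ?n\<^sup>2" using insert by auto
    have S: "?S (x(j := y)) = ?S x" for x y
      using insert(2) by (intro sum.cong) auto
    have ind: "(\<integral>x. (?S x) ^ p * g (x j) \<partial>?P) = (\<integral>x. (?S x) ^ p \<partial>?P) * (\<integral>y. g y \<partial>M j)" for p g
      using S by (intro integral_PiM_mult_coord I j M) simp
    have coord: "(\<integral>x. g (x j) \<partial>?P) = (\<integral>y. g y \<partial>M j)" for g :: "_ \<Rightarrow> real"
      by (intro integral_PiM_coord I j M)
    interpret Mj: prob_space "M j" using M by (simp add: finite_prob_space_def)
    have small: "(\<integral>y. \<xi> j y ^ p \<partial>M j) \<le> 1" for p
    proof -
      have "(\<integral>y. \<xi> j y ^ p \<partial>M j) \<le> (\<integral>y. 1 \<partial>M j)"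
      proof (rule integral_mono)
        fix y assume "y \<in> space (M j)"
        then have "\<bar>\<xi> j y ^ p\<bar> \<le> 1" using bound[OF j] by (simp add: power_abs power_le_one)
        then show "\<xi> j y ^ p \<le> 1" by linarith
      qed (use M in auto)
      then show ?thesis by (simp add: Mj.prob_space)
    qed
    have v: "v \<le> 1" using small[of 2] var[OF j] by simp
    have v0: "0 \<le> v" unfolding var[OF j, symmetric] by simp
    have sum: "(\<Sum>i\<in>insert j J. \<xi> i (x i)) = ?S x + \<xi> j (x j)" for x
      using insert by simp
    have 1: "(\<integral>x. (\<Sum>i\<in>insert j J. \<xi> i (x i)) \<partial>?P) = 0"
      unfolding sum using IH mean[OF j] coord[of "\<xi> j"] by simp
    have "(\<integral>x. (?S x + \<xi> j (x j))\<^sup>2 \<partial>?P) = (\<integral>x. (?S x)\<^sup>2 + 2 * (?S x ^ 1 * \<xi> j (x j)) + (\<xi> j (x j))\<^sup>2 \<partial>?P)"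
      by (intro Bochner_Integration.integral_cong refl) (simp add: power2_sum)
    also have "\<dots> = ?n * v + v"
      using IH mean[OF j] var[OF j] coord[of "\<lambda>y. (\<xi> j y)\<^sup>2"] ind[of 1 "\<xi> j"] by simp
    finally have 2: "(\<integral>x. (\<Sum>i\<in>insert j J. \<xi> i (x i))\<^sup>2 \<partial>?P) = real (card (insert j J)) * v"
      unfolding sum using insert by (simp add: algebra_simps)
    have "(\<integral>x. (?S x + \<xi> j (x j)) ^ 4 \<partial>?P) =
      (\<integral>x. ?S x ^ 4 + 4 * (?S x ^ 3 * \<xi> j (x j)) + 6 * (?S x ^ 2 * (\<xi> j (x j))\<^sup>2) +
        4 * (?S x ^ 1 * (\<xi> j (x j)) ^ 3) + \<xi> j (x j) ^ 4 \<partial>?P)"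
      by (intro Bochner_Integration.integral_cong refl)
        (simp add: power4_eq_xxxx power2_eq_square power3_eq_cube algebra_simps)
    also have "\<dots> = (\<integral>x. ?S x ^ 4 \<partial>?P) + 6 * (?n * v * v) + (\<integral>y. \<xi> j y ^ 4 \<partial>M j)"
      using IH mean[OF j] var[OF j] coord[of "\<lambda>y. \<xi> j y ^ 4"] ind[of 3 "\<xi> j"]
        ind[of 2 "\<lambda>y. (\<xi> j y)\<^sup>2"] ind[of 1 "\<lambda>y. \<xi> j y ^ 3"] by simp
    also have "\<dots> \<le> 3 * ?n\<^sup>2 + 6 * ?n + 3"
    proof -
      have "v * v \<le> 1" using v v0 by (simp add: mult_le_one)
      then have "?n * (v * v) \<le> ?n * 1" by (intro mult_left_mono) auto
      then have "?n * v * v \<le> ?n" by (simp add: mult.assoc)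
      then show ?thesis using IH(3) small[of 4] by linarith
    qed
    also have "\<dots> = 3 * (real (card (insert j J)))\<^sup>2"
      using insert by (simp add: power2_eq_square algebra_simps)
    finally have 3: "(\<integral>x. (\<Sum>i\<in>insert j J. \<xi> i (x i)) ^ 4 \<partial>?P) \<le> 3 * (real (card (insert j J)))\<^sup>2"
      unfolding sum .
    show ?case using 1 2 3 by blast
  qed
  then show "(\<integral>x. (\<Sum>i\<in>J. \<xi> i (x i)) \<partial>?P) = 0"
    "(\<integral>x. (\<Sum>i\<in>J. \<xi> i (x i))\<^sup>2 \<partial>?P) = real (card J) * v"
    "(\<integral>x. (\<Sum>i\<in>J. \<xi> i (x i)) ^ 4 \<partial>?P) \<le> 3 * (real (card J))\<^sup>2" by auto
qed

section \<open>Backlogs and the comparator\<close>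

lemma backlog_nonneg [simp]: "0 \<le> backlog z s t i"
  by (cases t) auto

lemma backlog_mono:
  assumes "\<And>\<tau>. 1 \<le> \<tau> \<Longrightarrow> \<tau> \<le> t \<Longrightarrow> z \<tau> i \<le> z' \<tau> i"
  shows "backlog z s t i \<le> backlog z' s t i"
  using assms
proof (induction t)
  case (Suc t)
  have "backlog z s t i \<le> backlog z' s t i" using Suc by simp
  moreover have "z (Suc t) i \<le> z' (Suc t) i" using Suc by simp
  ultimately show ?case unfolding backlog.simps by linarith
qed simp

lemma backlog_ge_sum: "(\<Sum>\<tau>=1..t. z \<tau> i - of_bool (s (\<tau>, i))) \<le> backlog z s t i"
  by (induction t) (auto simp: max_def)

lemma backlog_add_le:
  assumes "\<And>\<tau>. 1 \<le> \<tau> \<Longrightarrow> \<tau> \<le> t \<Longrightarrow> z \<tau> i \<le> y \<tau> i + e \<tau>" "\<And>\<tau>. 0 \<le> e \<tau>"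
  shows "backlog z s t i \<le> backlog y s t i + (\<Sum>\<tau>=1..t. e \<tau>)"
  using assms(1)
proof (induction t)
  case (Suc t)
  have "backlog z s t i \<le> backlog y s t i + (\<Sum>\<tau>=1..t. e \<tau>)" using Suc by simp
  moreover have "z (Suc t) i \<le> y (Suc t) i + e (Suc t)" using Suc.prems[of "Suc t"] by simp
  moreover have "0 \<le> (\<Sum>\<tau>=1..t. e \<tau>)" "0 \<le> e (Suc t)" using assms(2) by (auto intro: sum_nonneg)
  moreover have "(\<Sum>\<tau>=1..Suc t. e \<tau>) = (\<Sum>\<tau>=1..t. e \<tau>) + e (Suc t)" by simp
  ultimately show ?case unfolding backlog.simps(2) by linarith
qed simp

section \<open>Comparator allocations for a single affiliate\<close>

definition single_alloc :: "(nat \<Rightarrow> real) \<Rightarrow> nat \<Rightarrow> nat \<Rightarrow> real" where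
  "single_alloc x t i = (if i = 1 then x t else 0)"

lemma single_alloc_1 [simp]: "single_alloc x t 1 = x t" "single_alloc x t (Suc 0) = x t"
  by (simp_all add: single_alloc_def)

text \<open>
  The allocation \<open>y\<close> adds to \<open>h\<close> exactly the periods in which the server of \<open>h\<close> would be idle, so that
  no service is wasted and the queue is unchanged.
\<close>

lemma priority_alloc:
  fixes h :: "nat \<Rightarrow> real"
  assumes h: "\<And>t. h t \<in> {0, 1}"
  obtains y :: "nat \<Rightarrow> real"
  where "\<And>t. h t \<le> y t" "\<And>t. y t \<le> 1" "\<And>t. y t \<le> h t + of_bool (s (t, 1))"
    "\<And>t. backlog (single_alloc y) s t 1 = backlog (single_alloc h) s t 1"
    "\<And>t. (\<Sum>\<tau>=1..t. y \<tau>) = (\<Sum>\<tau>=1..t. of_bool (s (\<tau>, 1))) + backlog (single_alloc h) s t 1"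
proof -
  define b where "b t = backlog (single_alloc h) s t 1" for t
  define y where "y t = (if h t = 0 \<and> s (t, 1) \<and> b (t - 1) = 0 then 1 else h t)" for t
  have b0: "b 0 = 0" by (simp add: b_def)
  have b_Suc: "b (Suc t) = max 0 (b t + h (Suc t) - of_bool (s (Suc t, 1)))" for t
    by (simp add: b_def)
  \<comment> \<open>Integrality excludes queues strictly between 0 and 1. A service that meets a
    nonempty queue is then fully used, so the truncation at 0 never acts on
    \<open>y\<close>.\<close>
  have b_range: "b t = 0 \<or> 1 \<le> b t" for t
  proof -
    have "b t \<in> \<int>"
    proof (induction t)
      case (Suc t)
      have "h (Suc t) \<in> \<int>" using h[of "Suc t"] by auto
      then show ?case using Suc unfolding b_Suc max_def by (auto intro: Ints_add Ints_diff)
    qed (simp add: b0)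
    then obtain n where n: "b t = of_int n" by (elim Ints_cases)
    have "0 \<le> b t" by (simp add: b_def)
    then show ?thesis unfolding n by (metis of_int_0_le_iff of_int_1_le_iff of_int_0 zless_add1_eq int_one_le_iff_zero_less le_less)
  qed
  have step: "b t + y (Suc t) - of_bool (s (Suc t, 1)) = b (Suc t)" for t
    using b_range[of t] h[of "Suc t"] unfolding y_def b_Suc by auto
  have "h t \<le> y t" "y t \<le> 1" "y t \<le> h t + of_bool (s (t, 1))" for t
    using h[of t] by (auto simp: y_def)
  moreover have "backlog (single_alloc y) s t 1 = b t" for t
  proof (induction t)
    case (Suc t)
    then show ?case using step[of t] by (simp add: b_def)
  qed (simp add: b0)
  moreover have "(\<Sum>\<tau>=1..t. y \<tau>) = (\<Sum>\<tau>=1..t. of_bool (s (\<tau>, 1))) + b t" for t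
  proof (induction t)
    case (Suc t)
    then show ?case using step[of t] by simp
  qed (simp add: b0)
  ultimately show ?thesis using that unfolding b_def by blast
qed

text \<open>The allocation \<open>y\<close> of \<open>priority_alloc\<close> fills at least as much
  as there are services, so \<open>D\<close> bounds the capacity left over by \<open>y\<close>.
  \<open>G\<close> is a lower bound, free of \<open>y\<close>, on the room that \<open>y\<close>
  leaves in the last \<open>W\<close> periods. A deficit placed there is carried for at most
  \<open>W\<close> periods; if it does not fit, it is spread over all periods, at a cost of at most
  \<open>T * D\<close>.\<close>

lemma comparator_alloc:
  fixes h :: "nat \<Rightarrow> real" and s :: "nat \<times> nat \<Rightarrow> bool" and T W :: nat and c :: real
  assumes h: "\<And>t. h t \<in> {0, 1}" and c: "0 \<le> c" "c \<le> real T" and W: "W \<le> T"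
  defines "D \<equiv> max 0 (c - (\<Sum>t=1..T. of_bool (s (t, 1))))"
    and "G \<equiv> real W - (\<Sum>t\<in>{T-W<..T}. h t) - (\<Sum>t\<in>{T-W<..T}. of_bool (s (t, 1)))"
  obtains x :: "nat \<Rightarrow> real"
  where "\<And>t. 0 \<le> x t" "\<And>t. x t \<le> 1" "(\<Sum>t=1..T. x t) = c"
    "(\<Sum>t=1..T. h t * x t) = min c (\<Sum>t=1..T. h t)"
    "(\<Sum>t=1..T. backlog (single_alloc x) s t 1)
       \<le> (\<Sum>t=1..T. backlog (single_alloc h) s t 1) + real W * D + (if G < D then real T * D else 0)"
proof -
  define n where "n = (\<Sum>t=1..T. h t)"
  let ?b = "\<lambda>x t. backlog (single_alloc x) s t 1"
  have h01: "0 \<le> h t" "h t \<le> 1" "h t * h t = h t" for t using h[of t] by auto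
  have n0: "0 \<le> n" unfolding n_def using h01 by (simp add: sum_nonneg)
  have D0: "0 \<le> D" by (simp add: D_def)
  have extra: "0 \<le> real W * D + (if G < D then real T * D else 0)" using D0 by simp
  show ?thesis
  proof (cases "c < n")
    case True
    \<comment> \<open>The high cases alone exceed the capacity and are scaled down to it.\<close>
    define x where "x t = c / n * h t" for t
    have n: "0 < n" using True c by linarith
    have q: "0 \<le> c / n" "c / n \<le> 1" using True c n by auto
    have x: "0 \<le> x t" "x t \<le> h t" for t
      unfolding x_def using q h01(1)[of t] by (auto simp: mult_left_le_one_le simp del: times_divide_eq_left)
    have hx: "h t * x t = c / n * h t" for t using h01(3)[of t] by (simp add: x_def)
    have s1: "(\<Sum>t=1..T. x t) = c" unfolding x_def sum_distrib_left[symmetric] n_def[symmetric] using n by simp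
    have s2: "(\<Sum>t=1..T. h t * x t) = min c n"
      unfolding hx sum_distrib_left[symmetric] n_def[symmetric] using n True by simp
    have "?b x t \<le> ?b h t" for t using x by (intro backlog_mono) simp
    then have "(\<Sum>t=1..T. ?b x t) \<le> (\<Sum>t=1..T. ?b h t)" by (rule sum_mono)
    then have s3: "(\<Sum>t=1..T. ?b x t) \<le> (\<Sum>t=1..T. ?b h t) + real W * D + (if G < D then real T * D else 0)"
      using extra by linarith
    have x1: "x t \<le> 1" for t using x(2)[of t] h01(2)[of t] by linarith
    show ?thesis by (rule that[of x]) (fact x x1 s1 s2[unfolded n_def] s3)+
  next
    case False
    obtain y where y: "\<And>t. h t \<le> y t" "\<And>t. y t \<le> 1" "\<And>t. y t \<le> h t + of_bool (s (t, 1))"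
      "\<And>t. ?b y t = ?b h t"
      and ysum: "\<And>t. (\<Sum>\<tau>=1..t. y \<tau>) = (\<Sum>\<tau>=1..t. of_bool (s (\<tau>, 1))) + ?b h t"
      using priority_alloc[where h = h and s = s, OF h] by metis
    define Y where "Y = (\<Sum>t=1..T. y t)"
    have y0: "0 \<le> y t" for t using y(1)[of t] h01(1)[of t] by linarith
    have nY: "n \<le> Y" unfolding n_def Y_def using y(1) by (rule sum_mono)
    show ?thesis
    proof (cases "c \<le> Y")
      case True
      \<comment> \<open>Interpolation between \<open>h\<close> and \<open>y\<close>, whose queues
        agree. If \<open>Y = n\<close>, then also \<open>c = n\<close>, and division by zero gives
        the right value 0.\<close>
      define f where "f = (c - n) / (Y - n)"
      have f: "0 \<le> f" "f \<le> 1" "f * (Y - n) = c - n"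
        using True False nY by (auto simp: f_def divide_le_eq_1)
      define x where "x t = h t + f * (y t - h t)" for t
      have fy: "0 \<le> f * (y t - h t)" "f * (y t - h t) \<le> y t - h t" for t
        using f y(1)[of t] by (auto simp: mult_left_le_one_le)
      have x: "h t \<le> x t" "x t \<le> y t" for t
        using fy[of t] by (auto simp: x_def)
      have x0: "0 \<le> x t" and x1: "x t \<le> 1" for t
        using x[of t] h01[of t] y(2)[of t] by linarith+
      have s1: "(\<Sum>t=1..T. x t) = c"
        unfolding x_def sum.distrib sum_distrib_left[symmetric] sum_subtractf
        using f(3) unfolding n_def Y_def by simp
      have hx: "h t * x t = h t" for t using h[of t] x(1)[of t] x1[of t] by auto
      have s2: "(\<Sum>t=1..T. h t * x t) = min c n"
        unfolding hx n_def[symmetric] using False by simp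
      have "?b x t \<le> ?b h t" for t
        using backlog_mono[of t "single_alloc x" 1 "single_alloc y" s] x(2) y(4)[of t] by simp
      then have "(\<Sum>t=1..T. ?b x t) \<le> (\<Sum>t=1..T. ?b h t)" by (rule sum_mono)
      then have s3: "(\<Sum>t=1..T. ?b x t) \<le> (\<Sum>t=1..T. ?b h t) + real W * D + (if G < D then real T * D else 0)"
        using extra by linarith
      show ?thesis by (rule that[of x]) (fact x0 x1 s1 s2[unfolded n_def] s3)+
    next
      case cY: False
      have YD: "c - Y \<le> D"
        unfolding Y_def D_def ysum using backlog_nonneg[of "single_alloc h" s T 1] by linarith
      define win where "win = {T-W<..T}"
      define J where "J = (if c - Y \<le> (\<Sum>t\<in>win. 1 - y t) then win else {1..T})"
      have Jsub: "J \<subseteq> {1..T}" by (auto simp: J_def win_def)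
      have cwin: "card win = W" using W by (simp add: win_def)
      define R where "R = (\<Sum>t\<in>J. 1 - y t)"
      have "(\<Sum>t=1..T. 1 - y t) = real T - Y" by (simp add: sum_subtractf Y_def)
      then have R: "c - Y \<le> R" using c by (auto simp: R_def J_def)
      define f where "f = (c - Y) / R"
      have f: "0 \<le> f" "f \<le> 1" "f * R = c - Y" using R cY by (auto simp: f_def divide_le_eq_1)
      define e where "e t = (if t \<in> J then f * (1 - y t) else 0)" for t
      have e: "0 \<le> e t" "e t \<le> 1 - y t" for t
        using f y(2)[of t] by (auto simp: e_def mult_left_le_one_le)
      have esum: "(\<Sum>t=1..T. e t) = c - Y"
      proof -
        have "(\<Sum>t=1..T. e t) = (\<Sum>t\<in>{1..T} \<inter> J. f * (1 - y t))"
          unfolding e_def by (simp only: sum.inter_restrict finite_atLeastAtMost)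
        also have "{1..T} \<inter> J = J" using Jsub by blast
        finally show ?thesis using f(3) by (simp add: R_def sum_distrib_left)
      qed
      define x where "x t = y t + e t" for t
      have x0: "0 \<le> x t" and x1: "x t \<le> 1" for t
        using y0[of t] e[of t] unfolding x_def by linarith+
      have s1: "(\<Sum>t=1..T. x t) = c"
        using esum by (simp add: x_def sum.distrib Y_def)
      have hx: "h t * x t = h t" for t using h[of t] y(1)[of t] e(1)[of t] x1[of t] by (auto simp: x_def)
      have s2: "(\<Sum>t=1..T. h t * x t) = min c n"
        unfolding hx n_def[symmetric] using False by simp
      have bx: "?b x t \<le> ?b h t + (\<Sum>\<tau>=1..t. e \<tau>)" for t
        using backlog_add_le[of t "single_alloc x" 1 "single_alloc y" e s] e(1) y(4)[of t] by (simp add: x_def)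
      have et: "(\<Sum>\<tau>=1..t. e \<tau>) \<le> D" if "t \<le> T" for t
      proof -
        have "(\<Sum>\<tau>=1..t. e \<tau>) \<le> (\<Sum>\<tau>=1..T. e \<tau>)" using that e by (intro sum_mono2) auto
        then show ?thesis using esum YD by linarith
      qed
      have "(\<Sum>t=1..T. \<Sum>\<tau>=1..t. e \<tau>) \<le> real W * D + (if G < D then real T * D else 0)"
      proof (cases "J = win")
        case True
        have "(\<Sum>t=1..T. \<Sum>\<tau>=1..t. e \<tau>) \<le> (\<Sum>t=1..T. if t \<in> win then D else 0)"
        proof (rule sum_mono)
          fix t assume t: "t \<in> {1..T}"
          show "(\<Sum>\<tau>=1..t. e \<tau>) \<le> (if t \<in> win then D else 0)"
          proof (cases "t \<in> win")
            case False
            then have "e \<tau> = 0" if "\<tau> \<in> {1..t}" for \<tau>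
              using that t True by (auto simp: e_def win_def)
            then show ?thesis using False by simp
          qed (use et t in auto)
        qed
        also have "\<dots> = (\<Sum>t\<in>{1..T} \<inter> win. D)" by (simp only: sum.inter_restrict finite_atLeastAtMost)
        also have "{1..T} \<inter> win = win" by (auto simp: win_def)
        also have "(\<Sum>t\<in>win. D) = real W * D" using cwin by simp
        finally show ?thesis using D0 by (auto simp: add_increasing2)
      next
        case False
        have "(\<Sum>t\<in>win. 1 - h t - of_bool (s (t, 1))) \<le> (\<Sum>t\<in>win. 1 - y t)"
        proof (rule sum_mono)
          fix t show "1 - h t - of_bool (s (t, 1)) \<le> 1 - y t" using y(3)[of t] by linarith
        qed
        moreover have "(\<Sum>t\<in>win. 1 - h t - of_bool (s (t, 1))) = G"
          unfolding G_def sum_subtractf using cwin by (simp add: win_def)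
        moreover have "(\<Sum>t\<in>win. 1 - y t) < c - Y" using False by (auto simp: J_def split: if_splits)
        ultimately have "G < D" using YD by linarith
        have "(\<Sum>t=1..T. \<Sum>\<tau>=1..t. e \<tau>) \<le> (\<Sum>t=1..T. D)" using et by (intro sum_mono) auto
        then show ?thesis using \<open>G < D\<close> D0 by (simp add: add_increasing)
      qed
      moreover have "(\<Sum>t=1..T. ?b x t) \<le> (\<Sum>t=1..T. ?b h t) + (\<Sum>t=1..T. \<Sum>\<tau>=1..t. e \<tau>)"
        unfolding sum.distrib[symmetric] using bx by (rule sum_mono)
      ultimately have s3: "(\<Sum>t=1..T. ?b x t) \<le> (\<Sum>t=1..T. ?b h t) + real W * D + (if G < D then real T * D else 0)"
        by linarith
      show ?thesis by (rule that[of x]) (fact x0 x1 s1 s2[unfolded n_def] s3)+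
    qed
  qed
qed

section \<open>Duals along a sample path\<close>

text \<open>
  Index \<open>n\<close> refers to period \<open>n + 1\<close>: its reward \<open>w n\<close> and decision \<open>z n\<close>, and the remaining capacity
  \<open>cc n\<close> and the duals \<open>th n\<close>, \<open>la n\<close> on which that decision is based.
\<close>

locale dual_path =
  fixes k \<alpha> :: real and T :: nat and w z cc th la :: "nat \<Rightarrow> real"
  assumes k: "0 < k" and alpha: "0 \<le> \<alpha>"
    and cc_0: "cc 0 = real T / 2" and th_0: "th 0 = exp (- 1)" and la_0: "la 0 = exp (- 1)"
    and cc_Suc: "cc (Suc n) = cc n - z n"
    and th_Suc: "th (Suc n) = min (th n * exp (k / sqrt (real (Suc n)) * (z n - 1 / 2))) \<alpha>"
    and la_Suc: "la (Suc n) = min (la n * exp (k / sqrt (real (Suc n)) * (z n - 1 / 2))) (2 * (1 + 2 * \<alpha>))"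
    and z01: "n < T \<Longrightarrow> z n \<in> {0, 1}"
    and w: "n < T \<Longrightarrow> w n \<in> {1 / 10, 7 / 10}"
    and accept: "n < T \<Longrightarrow> 0 < cc n \<Longrightarrow> th n + la n < w n \<Longrightarrow> z n = 1"
    and reject: "n < T \<Longrightarrow> w n < th n + la n \<Longrightarrow> z n = 0"
    and exhausted: "n < T \<Longrightarrow> cc n \<le> 0 \<Longrightarrow> z n = 0"
begin

definition u :: "nat \<Rightarrow> real" where "u n = th n + la n"

text \<open>On the logarithmic scale the updates are additive, up to the caps; \<open>V\<close> is
  the part above the price 1 / 10.\<close>

definition V :: "nat \<Rightarrow> real" where "V n = max 0 (ln (10 * u n))"

abbreviation \<eta> :: "nat \<Rightarrow> real" where "\<eta> n \<equiv> k / sqrt (real (Suc n))"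

lemma eta_bounds: "0 < \<eta> n" "\<eta> n \<le> k"
  using k by (auto simp: divide_le_eq mult_le_cancel_left1)

lemma cc_eq: "cc n = real T / 2 - (\<Sum>i<n. z i)"
  by (induction n) (simp_all add: cc_0 cc_Suc)

lemma cc_le: "m \<le> n \<Longrightarrow> n \<le> T \<Longrightarrow> cc n \<le> cc m"
proof (induction n rule: dec_induct)
  case (step n)
  then show ?case using z01[of n] by (auto simp: cc_Suc)
qed simp

lemma total_le: "n \<le> T \<Longrightarrow> (\<Sum>i<n. z i) \<le> real T / 2 + 1"
proof (induction n)
  case (Suc n)
  show ?case
  proof (cases "cc n \<le> 0")
    case True
    then show ?thesis using Suc exhausted[of n] by simp
  next
    case False
    then show ?thesis using Suc z01[of n] cc_eq[of n] by auto
  qed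
qed simp

section \<open>One-step bounds on the capped duals\<close>

lemma th_nonneg: "0 \<le> th n"
  by (induction n) (auto simp: th_0 th_Suc alpha)

lemma la_pos: "0 < la n"
  using alpha by (induction n) (auto simp: la_0 la_Suc)

lemma u_pos: "0 < u n" using th_nonneg[of n] la_pos[of n] by (simp add: u_def)

text \<open>Only from index 1 on, because the initial value exp (- 1) may exceed \<alpha>; the lower
  bounds on \<open>u (Suc n)\<close> inherit this condition.\<close>

lemma th_le: "0 < n \<Longrightarrow> th n \<le> \<alpha>"
  by (cases n) (auto simp: th_Suc)

lemma la_le: "la n \<le> 2 * (1 + 2 * \<alpha>)"
proof (cases n)
  case 0
  then have "la n \<le> 1" using la_0 by simp
  then show ?thesis using alpha by (simp add: distrib_left)
qed (auto simp: la_Suc)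

lemma u_Suc_le: "u (Suc n) \<le> u n * exp (\<eta> n * (z n - 1 / 2))"
  unfolding u_def th_Suc la_Suc by (simp add: distrib_right)

lemma ln_u_Suc_le: "ln (u (Suc n)) \<le> ln (u n) + \<eta> n * (z n - 1 / 2)"
proof -
  have "ln (u (Suc n)) \<le> ln (u n * exp (\<eta> n * (z n - 1 / 2)))"
    using u_Suc_le u_pos by simp
  then show ?thesis using u_pos[of n] by (simp add: ln_mult)
qed

text \<open>The caps work against a lower bound, but each dual already lies below its cap, so
  capping cannot push it below its present value, let alone below the discounted one.\<close>

lemma u_Suc_ge:
  assumes "0 < n" "n < T"
  shows "u n * exp (- \<eta> n / 2) \<le> u (Suc n)"
proof -
  let ?x = "exp (- \<eta> n / 2)" and ?e = "exp (\<eta> n * (z n - 1 / 2))"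
  have e: "?x \<le> ?e"
    using z01[OF assms(2)] eta_bounds(1)[of n] by (auto simp: algebra_simps)
  have x1: "?x \<le> 1" using eta_bounds(1)[of n] by simp
  have "th n * ?x \<le> th n * ?e" using e th_nonneg by (intro mult_left_mono)
  moreover have "th n * ?x \<le> \<alpha>"
    using th_le[OF assms(1)] x1 th_nonneg[of n] mult_left_le[of ?x "th n"] by linarith
  ultimately have 1: "th n * ?x \<le> th (Suc n)" unfolding th_Suc by simp
  have "la n * ?x \<le> la n * ?e" using e la_pos[of n] by (intro mult_left_mono) auto
  moreover have "la n * ?x \<le> 2 * (1 + 2 * \<alpha>)"
    using la_le[of n] x1 la_pos[of n] mult_left_le[of ?x "la n"] by linarith
  ultimately have 2: "la n * ?x \<le> la (Suc n)" unfolding la_Suc by simp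
  show ?thesis using 1 2 by (simp add: u_def distrib_right)
qed

lemma u_Suc_ge_accept:
  assumes "0 < n" "z n = 1"
  shows "u n \<le> u (Suc n)"
proof -
  let ?e = "exp (\<eta> n * (z n - 1 / 2))"
  have e: "1 \<le> ?e" using assms eta_bounds(1)[of n] by simp
  have "th n * 1 \<le> th n * ?e" using e th_nonneg by (intro mult_left_mono)
  then have 1: "th n \<le> th (Suc n)" using th_le[OF assms(1)] unfolding th_Suc by simp
  have "la n * 1 \<le> la n * ?e" using e la_pos[of n] by (intro mult_left_mono) auto
  then have 2: "la n \<le> la (Suc n)" using la_le[of n] unfolding la_Suc by simp
  show ?thesis using 1 2 by (simp add: u_def)
qed

section \<open>Lyapunov function of the duals\<close>

lemma V_nonneg [simp]: "0 \<le> V n" by (simp add: V_def)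

lemma V_0: "V 0 \<le> 3"
proof -
  have "10 * u 0 \<le> 20" by (simp add: u_def th_0 la_0)
  also have "20 \<le> exp (3 :: real)"
  proof -
    have "(2.717 :: real) ^ 3 \<le> exp 1 ^ 3"
      using e_approx_32 by (intro power_mono) (auto simp: abs_if split: if_splits)
    also have "\<dots> = exp 3" by (simp flip: exp_of_nat_mult)
    finally show ?thesis by (simp add: power3_eq_cube)
  qed
  finally have "ln (10 * u 0) \<le> ln (exp 3)"
    using u_pos[of 0] by (subst ln_le_cancel_iff) auto
  then show ?thesis by (simp add: V_def)
qed

text \<open>
  Above the level \<open>1 / 10\<close> only high cases can be accepted; they have probability \<open>1 / 4 < 1 / 2\<close>,
  which makes the drift of \<open>V\<close> negative.
\<close>

lemma V_Suc:
  assumes n: "n < T"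
  defines "h \<equiv> of_bool (w n = 7 / 10)"
  shows "(V (Suc n))\<^sup>2 \<le> (V n)\<^sup>2 + 2 * \<eta> n * (V n * (h - 1 / 2)) + (\<eta> n)\<^sup>2"
proof -
  have lnu: "ln (10 * u m) = ln 10 + ln (u m)" for m
    using u_pos[of m] by (simp add: ln_mult)
  define g where "g = \<eta> n"
  have g: "0 < g" using eta_bounds(1) by (simp add: g_def)
  show ?thesis
  \<comment> \<open>From below the price, one step lifts \<open>V\<close> to at most the step size,
    which the last summand absorbs. Above the price a low case is rejected, so
    \<open>z n \<le> h\<close>.\<close>
  proof (cases "u n \<le> 1 / 10")
    case True
    then have "ln (10 * u n) \<le> 0" using u_pos[of n] by simp
    then have V: "V n = 0" "ln (10 * u (Suc n)) \<le> g * (z n - 1 / 2)"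
      using ln_u_Suc_le[of n] by (simp_all add: V_def lnu g_def)
    have "g * (z n - 1 / 2) \<le> g * 1" using z01[OF n] g by (intro mult_left_mono) auto
    then have "g * (z n - 1 / 2) \<le> g" by simp
    then have "ln (10 * u (Suc n)) \<le> g" using V(2) by linarith
    then have "0 \<le> V (Suc n)" "V (Suc n) \<le> g" using g by (auto simp: V_def)
    then have "(V (Suc n))\<^sup>2 \<le> g\<^sup>2" by (intro power_mono)
    then show ?thesis using V by (simp add: g_def)
  next
    case False
    have V: "V n = ln (10 * u n)" using False by (simp add: V_def)
    have "z n \<le> h"
      using w[OF n] reject[OF n] z01[OF n] False by (auto simp: h_def u_def)
    then have "g * (z n - 1 / 2) \<le> g * (h - 1 / 2)" using g by simp
    then have "ln (10 * u (Suc n)) \<le> V n + g * (h - 1 / 2)"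
      using ln_u_Suc_le[of n] V by (simp add: lnu g_def)
    then have "V (Suc n) \<le> max 0 (V n + g * (h - 1 / 2))" by (simp add: V_def)
    then have "(V (Suc n))\<^sup>2 \<le> (max 0 (V n + g * (h - 1 / 2)))\<^sup>2"
      by (intro power_mono) auto
    also have "\<dots> \<le> (V n + g * (h - 1 / 2))\<^sup>2"
      by (simp add: max_def)
    also have "\<dots> = (V n)\<^sup>2 + 2 * g * (V n * (h - 1 / 2)) + g\<^sup>2 * (h - 1 / 2)\<^sup>2"
      by (simp add: power2_eq_square algebra_simps)
    also have "(h - 1 / 2)\<^sup>2 = 1 / 4" by (simp add: h_def power2_eq_square)
    finally show ?thesis using zero_le_power2[of g] unfolding g_def[symmetric] by linarith
  qed
qed

text \<open>\<open>V_Suc\<close> telescoped. When the indicator is later replaced by its conditional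
  mean 1 / 4, the factor 1 / 2 - 1 / 4 is positive, and the sum of \<open>V\<close> weighted by the
  step sizes is bounded by a harmonic sum.\<close>

lemma sum_V_le:
  assumes "N \<le> T"
  shows "(\<Sum>n<N. 2 * \<eta> n * (V n * (1 / 2 - of_bool (w n = 7 / 10)))) \<le> 9 + (\<Sum>n<N. (\<eta> n)\<^sup>2)"
proof -
  have "(V N)\<^sup>2 + (\<Sum>n<N. 2 * \<eta> n * (V n * (1 / 2 - of_bool (w n = 7 / 10)))) \<le> (V 0)\<^sup>2 + (\<Sum>n<N. (\<eta> n)\<^sup>2)"
    using assms
  proof (induction N)
    case (Suc N)
    have "2 * \<eta> N * (V N * (1 / 2 - of_bool (w N = 7 / 10))) = - (2 * \<eta> N * (V N * (of_bool (w N = 7 / 10) - 1 / 2)))"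
      by (simp add: algebra_simps)
    then show ?case using Suc V_Suc[of N] by (simp only: sum.lessThan_Suc) linarith
  qed simp
  moreover have "(V 0)\<^sup>2 \<le> 3\<^sup>2" using V_0 by (intro power_mono) auto
  then have "(V 0)\<^sup>2 \<le> 9" by simp
  moreover have "0 \<le> (V N)\<^sup>2" by simp
  ultimately show ?thesis by linarith
qed

text \<open>
  Summation by parts against the weights \<open>1 / \<eta>\<close>: the allocations in excess of the rate \<open>1 / 2\<close>
  are controlled by the logarithm of the sum of the duals.
\<close>

lemma surplus_ge_aux:
  "sqrt (real N) * ln (u N) - (\<Sum>n<N. (sqrt (real (Suc n)) - sqrt (real n)) * ln (u n))
     \<le> k * (\<Sum>n<N. z n - 1 / 2)"
proof (induction N)
  case (Suc N)
  have "sqrt (real (Suc N)) * (ln (u (Suc N)) - ln (u N)) \<le> sqrt (real (Suc N)) * (\<eta> N * (z N - 1 / 2))"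
    using ln_u_Suc_le[of N] by (intro mult_left_mono) auto
  also have "\<dots> = k * (z N - 1 / 2)" by simp
  finally show ?case using Suc by (simp add: algebra_simps)
qed simp

text \<open>The weights sqrt (n + 1) - sqrt n add up to sqrt N, so their terms ln (1 / 10) cancel
  against the one at time \<open>N\<close>. What remains is the shortfall \<epsilon> of the last
  dual and the excess \<open>V\<close> along the way.\<close>

lemma surplus_ge:
  assumes u: "ln (1 / 10) - \<epsilon> \<le> ln (u N)"
  shows "- \<epsilon> * sqrt (real N) - (\<Sum>n<N. V n / sqrt (real (Suc n))) \<le> k * (\<Sum>n<N. z n - 1 / 2)"
proof -
  let ?d = "\<lambda>n. sqrt (real (Suc n)) - sqrt (real n)"
  have lnu: "ln (u m) \<le> ln (1 / 10) + V m" for m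
    using u_pos[of m] by (simp add: ln_mult ln_div V_def)
  have d: "0 \<le> ?d n" "?d n \<le> 1 / sqrt (real (Suc n))" for n
  proof -
    show "0 \<le> ?d n" by simp
    have "sqrt (real (Suc n)) * ?d n = real (Suc n) - sqrt (real (Suc n)) * sqrt (real n)"
      by (simp add: algebra_simps)
    also have "sqrt (real n) * sqrt (real n) \<le> sqrt (real (Suc n)) * sqrt (real n)"
      by (intro mult_right_mono) auto
    then have "real (Suc n) - sqrt (real (Suc n)) * sqrt (real n) \<le> 1" by simp
    finally show "?d n \<le> 1 / sqrt (real (Suc n))" by (simp add: field_simps)
  qed
  have dsum: "(\<Sum>n<N. ?d n) = sqrt (real N)" by (induction N) auto
  have "(\<Sum>n<N. ?d n * ln (u n)) \<le> (\<Sum>n<N. ?d n * ln (1 / 10) + V n / sqrt (real (Suc n)))"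
  proof (rule sum_mono)
    fix n
    have "?d n * ln (u n) \<le> ?d n * (ln (1 / 10) + V n)"
      using lnu d by (intro mult_left_mono)
    also have "?d n * V n \<le> 1 / sqrt (real (Suc n)) * V n"
      using d by (intro mult_right_mono) auto
    then have "?d n * (ln (1 / 10) + V n) \<le> ?d n * ln (1 / 10) + V n / sqrt (real (Suc n))"
      by (simp add: distrib_left)
    finally show "?d n * ln (u n) \<le> ?d n * ln (1 / 10) + V n / sqrt (real (Suc n))" .
  qed
  also have "\<dots> = sqrt (real N) * ln (1 / 10) + (\<Sum>n<N. V n / sqrt (real (Suc n)))"
    by (simp only: sum.distrib sum_distrib_right[symmetric] dsum)
  finally have 1: "(\<Sum>n<N. ?d n * ln (u n)) \<le> sqrt (real N) * ln (1 / 10) + (\<Sum>n<N. V n / sqrt (real (Suc n)))" .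
  have "sqrt (real N) * (ln (1 / 10) - \<epsilon>) \<le> sqrt (real N) * ln (u N)"
    using u by (intro mult_left_mono) auto
  then show ?thesis using 1 surplus_ge_aux[of N] by (simp add: algebra_simps)
qed

text \<open>Crude, but it serves only at a fixed time \<open>n1\<close>, as a starting value for the
  growth that depends neither on the path nor on \<alpha> and \<open>T\<close>.\<close>

lemma la_lower: "n \<le> T \<Longrightarrow> exp (- 1 - k * real n) \<le> la n"
proof (induction n)
  case (Suc n)
  have "\<eta> n * (- 1 / 2) \<le> \<eta> n * (z n - 1 / 2)"
    using z01[of n] Suc.prems eta_bounds(1)[of n] by (intro mult_left_mono) auto
  then have "- k \<le> \<eta> n * (z n - 1 / 2)" using eta_bounds[of n] by simp
  then have "exp (- 1 - k * real n) * exp (- k) \<le> la n * exp (\<eta> n * (z n - 1 / 2))"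
    using Suc la_pos[of n] by (intro mult_mono) auto
  moreover have "exp (- 1 - k * real n) * exp (- k) = exp (- 1 - k * real (Suc n))"
    by (simp add: mult_exp_exp algebra_simps)
  moreover have "exp (- 1 - k * real (Suc n)) \<le> 2 * (1 + 2 * \<alpha>)"
  proof -
    have "0 \<le> k * real (Suc n)" using k by simp
    then have "exp (- 1 - k * real (Suc n)) \<le> exp 0" by (intro exp_le_cancel_iff[THEN iffD2]) linarith
    also have "exp 0 \<le> 2 * (1 + 2 * \<alpha>)" using alpha by simp
    finally show ?thesis .
  qed
  ultimately show ?case unfolding la_Suc by simp
qed (simp add: la_0)

text \<open>
  As long as \<open>u\<close> is below \<open>1 / 10\<close>, every case is accepted and \<open>la\<close> grows geometrically with rate
  \<open>\<eta> n / 2\<close>; a step that starts above \<open>1 / 10\<close> cannot fall below \<open>exp (- \<epsilon>) / 10\<close> any more.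
\<close>

lemma u_dichotomy:
  assumes n1: "0 < n1" "k / sqrt (real (Suc n1)) \<le> \<epsilon>" "k / sqrt (real (Suc n1)) \<le> 1"
    and "n1 \<le> N" "N \<le> T" and cc: "\<And>n. n < N \<Longrightarrow> 0 < cc n"
  shows "exp (- \<epsilon>) / 10 \<le> u N \<or>
    exp (- 1 - k * real n1 + k / 2 * (real N - real n1) / sqrt (real N)) \<le> la N"
proof -
  have eta_le: "\<eta> n \<le> \<eta> n1" if "n1 \<le> n" for n
    using that k by (intro divide_left_mono) auto
  have "exp (- \<epsilon>) / 10 \<le> u N \<or> exp (- 1 - k * real n1 + (\<Sum>n=n1..<N. \<eta> n / 2)) \<le> la N"
    using assms(4,5) cc
  proof (induction N rule: dec_induct)
    case base
    then show ?case using la_lower[of n1] by simp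
  next
    case (step n)
    have n: "0 < n" "n < T" using n1 step by auto
    have en: "\<eta> n \<le> \<epsilon>" "\<eta> n \<le> 1"
      using eta_le[OF step(1)] assms(2,3) by linarith+
    show ?case
    proof (cases "1 / 10 \<le> u n")
      case True
      have "exp (- \<epsilon>) * (1 / 10) \<le> exp (- \<eta> n / 2) * u n"
        using en True eta_bounds(1)[of n] by (intro mult_mono) auto
      then show ?thesis using u_Suc_ge[OF n] by (auto simp: mult.commute)
    next
      case False
      then have z: "z n = 1"
        using accept[of n] n w[OF n(2)] step.prems(2)[of n] by (auto simp: u_def)
      from step have "exp (- \<epsilon>) / 10 \<le> u n \<or> exp (- 1 - k * real n1 + (\<Sum>n=n1..<n. \<eta> n / 2)) \<le> la n"
        by simp
      then show ?thesis
      proof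
        assume "exp (- \<epsilon>) / 10 \<le> u n"
        then show ?thesis using u_Suc_ge_accept[OF n(1) z] by simp
      next
        assume *: "exp (- 1 - k * real n1 + (\<Sum>n=n1..<n. \<eta> n / 2)) \<le> la n"
        \<comment> \<open>The growth is traced on \<open>la\<close> because the cap \<alpha> of
          \<open>th\<close> may be 0. The cap of \<open>la\<close> is at least 2 and inactive here,
          since one step multiplies a value of at most 1 / 10 by at most 3.\<close>
        have "la n \<le> 1 / 10" using False th_nonneg[of n] by (simp add: u_def)
        moreover have "\<eta> n / 2 \<le> 1 / 2" by (rule divide_right_mono[OF en(2)]) simp
        then have "\<eta> n / 2 \<le> 1" by (rule order_trans) simp
        then have "exp (\<eta> n / 2) \<le> exp 1" by (rule exp_le_cancel_iff[THEN iffD2])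
        then have "exp (\<eta> n / 2) \<le> 3" using exp_le by linarith
        ultimately have "la n * exp (\<eta> n / 2) \<le> 1 / 10 * 3"
          using la_pos[of n] by (intro mult_mono) auto
        then have la: "la (Suc n) = la n * exp (\<eta> n / 2)"
          unfolding la_Suc z using alpha by simp
        have "exp (- 1 - k * real n1 + (\<Sum>n=n1..<Suc n. \<eta> n / 2)) =
          exp (- 1 - k * real n1 + (\<Sum>n=n1..<n. \<eta> n / 2)) * exp (\<eta> n / 2)"
          using step by (simp add: mult_exp_exp add.assoc)
        also have "\<dots> \<le> la n * exp (\<eta> n / 2)" using * by (intro mult_right_mono) auto
        finally show ?thesis unfolding la by blast
      qed
    qed
  qed
  moreover have "k / 2 * (real N - real n1) / sqrt (real N) \<le> (\<Sum>n=n1..<N. \<eta> n / 2)"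
  proof -
    have "(\<Sum>n=n1..<N. k / sqrt (real N) / 2) \<le> (\<Sum>n=n1..<N. \<eta> n / 2)"
      using k by (intro sum_mono divide_right_mono divide_left_mono) auto
    then show ?thesis using assms(4) by (simp add: of_nat_diff field_simps)
  qed
  then have "exp (- 1 - k * real n1 + k / 2 * (real N - real n1) / sqrt (real N))
    \<le> exp (- 1 - k * real n1 + (\<Sum>n=n1..<N. \<eta> n / 2))" by simp
  ultimately show ?thesis by linarith
qed

end

text \<open>Stated outside the locale so that \<open>N0\<close> depends on \<open>k\<close> and
  \<epsilon> alone. After a time \<open>n1\<close> from which the steps are small, the growth
  exponent of order sqrt N outweighs the loss \<open>1 + k * n1\<close> before it; the second
  alternative of \<open>u_dichotomy\<close> then puts \<open>la\<close> above 1, far above the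
  price.\<close>

lemma dual_path_lower:
  assumes k: "0 < k" and \<epsilon>: "0 < \<epsilon>"
  obtains N0 where "\<And>\<alpha> T w z cc th la N. dual_path k \<alpha> T w z cc th la \<Longrightarrow> N0 \<le> N \<Longrightarrow> N \<le> T \<Longrightarrow>
    (\<And>n. n < N \<Longrightarrow> 0 < cc n) \<Longrightarrow> ln (1 / 10) - \<epsilon> \<le> ln (dual_path.u th la N)"
proof -
  have "(\<lambda>n. k / sqrt (real (Suc n))) \<longlonglongrightarrow> 0" by real_asymp
  then have "eventually (\<lambda>n. k / sqrt (real (Suc n)) < min \<epsilon> 1) sequentially"
    using \<epsilon> by (intro order_tendstoD) auto
  moreover have "eventually (\<lambda>n::nat. 0 < n) sequentially" by real_asymp
  ultimately have "eventually (\<lambda>n. k / sqrt (real (Suc n)) < min \<epsilon> 1 \<and> 0 < n) sequentially"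
    by eventually_elim auto
  then obtain n1 :: nat where n1: "0 < n1" "k / sqrt (real (Suc n1)) < min \<epsilon> 1"
    by (auto simp: eventually_sequentially)
  define x where "x = real n1"
  have "filterlim (\<lambda>N. - 1 - k * x + k / 2 * (real N - x) / sqrt (real N)) at_top sequentially"
    using k by real_asymp
  then have "eventually (\<lambda>N. 0 \<le> - 1 - k * x + k / 2 * (real N - x) / sqrt (real N)) sequentially"
    by (simp add: filterlim_at_top)
  then obtain N1 where N1: "\<And>N. N1 \<le> N \<Longrightarrow> 0 \<le> - 1 - k * x + k / 2 * (real N - x) / sqrt (real N)"
    by (auto simp: eventually_sequentially)
  show thesis
  proof (rule that[of "max n1 N1"])
    fix \<alpha> T w z cc th la N
    assume *: "dual_path k \<alpha> T w z cc th la" "max n1 N1 \<le> N" "N \<le> T" "\<And>n. n < N \<Longrightarrow> 0 < cc n"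
    interpret dual_path k \<alpha> T w z cc th la by (rule *(1))
    have e1: "exp (- \<epsilon>) \<le> 1" using \<epsilon> by simp
    have "exp (- \<epsilon>) / 10 \<le> u N"
    proof (rule disjE[OF u_dichotomy[of n1 \<epsilon> N]])
      assume la: "exp (- 1 - k * real n1 + k / 2 * (real N - real n1) / sqrt (real N)) \<le> la N"
      have "1 \<le> exp (- 1 - k * real n1 + k / 2 * (real N - real n1) / sqrt (real N))"
        using N1[of N] * by (simp add: x_def)
      then have "1 \<le> la N" using la by linarith
      then show ?thesis using th_nonneg[of N] e1 unfolding u_def by linarith
    qed (use n1 * in auto)
    then have "ln (exp (- \<epsilon>) / 10) \<le> ln (u N)" using u_pos[of N] by (subst ln_le_cancel_iff) auto
    then show "ln (1 / 10) - \<epsilon> \<le> ln (u N)" by (simp add: ln_div)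
  qed
qed

text \<open>If the capacity runs out before \<open>N\<close>, at least T / 2 \<ge> N / 2 units have
  been allocated and the surplus is nonnegative; otherwise \<open>dual_path_lower\<close>
  applies.\<close>

lemma dual_path_surplus:
  assumes k: "0 < k" and \<epsilon>: "0 < \<epsilon>"
  obtains N0 where "\<And>\<alpha> T w z cc th la N. dual_path k \<alpha> T w z cc th la \<Longrightarrow> N0 \<le> N \<Longrightarrow> N \<le> T \<Longrightarrow>
    - \<epsilon> * sqrt (real N) - (\<Sum>n<N. dual_path.V th la n / sqrt (real (Suc n))) \<le> k * (\<Sum>n<N. z n - 1 / 2)"
proof -
  obtain N0 where N0: "\<And>\<alpha> T w z cc th la N. dual_path k \<alpha> T w z cc th la \<Longrightarrow> N0 \<le> N \<Longrightarrow> N \<le> T \<Longrightarrow>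
    (\<And>n. n < N \<Longrightarrow> 0 < cc n) \<Longrightarrow> ln (1 / 10) - \<epsilon> \<le> ln (dual_path.u th la N)"
    using dual_path_lower[OF assms] by metis
  show thesis
  proof (rule that)
    fix \<alpha> T w z cc th la N
    assume *: "dual_path k \<alpha> T w z cc th la" "N0 \<le> N" "N \<le> T"
    interpret dual_path k \<alpha> T w z cc th la by (rule *(1))
    show "- \<epsilon> * sqrt (real N) - (\<Sum>n<N. V n / sqrt (real (Suc n))) \<le> k * (\<Sum>n<N. z n - 1 / 2)"
    proof (cases "\<forall>n<N. 0 < cc n")
      case True
      then show ?thesis using surplus_ge N0[OF *] by simp
    next
      case False
      then obtain n where "n < N" "cc n \<le> 0" by (auto simp: not_less)
      then have "cc N \<le> 0" using cc_le[of n N] * by simp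
      then have "0 \<le> (\<Sum>n<N. z n) - real N / 2" using cc_eq[of N] * by simp
      then have "0 \<le> k * (\<Sum>n<N. z n - 1 / 2)" using k by (simp add: sum_subtractf)
      moreover have "0 \<le> \<epsilon> * sqrt (real N)" using \<epsilon> by simp
      moreover have "0 \<le> (\<Sum>n<N. V n / sqrt (real (Suc n)))" by (intro sum_nonneg divide_nonneg_nonneg) auto
      ultimately show ?thesis by linarith
    qed
  qed
qed

section \<open>The instance\<close>

definition high_case :: case_type where "high_case = ((\<lambda>_. 7 / 10), 0)"
definition low_case :: case_type where "low_case = ((\<lambda>_. 1 / 10), 0)"

text \<open>The target is the two-point space rather than all case types, so that
  \<open>finite_prob_space\<close> applies.\<close>

definition arrivals :: "case_type measure" where
  "arrivals = distr (measure_pmf (bernoulli_pmf (1 / 4))) (count_space {low_case, high_case})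
     (\<lambda>b. if b then high_case else low_case)"

definition is_high :: "case_type \<Rightarrow> real" where
  "is_high x = of_bool (fst x 1 = 7 / 10)"

lemma is_high_simps [simp]: "is_high high_case = 1" "is_high low_case = 0"
  by (simp_all add: is_high_def high_case_def low_case_def)

lemma is_high_01: "is_high x \<in> {0, 1}"
  by (simp add: is_high_def)

lemma space_arrivals: "space arrivals = {low_case, high_case}"
  by (simp add: arrivals_def)

lemma finite_prob_space_arrivals: "finite_prob_space arrivals"
  unfolding finite_prob_space_def
proof (intro conjI)
  show "prob_space arrivals"
    unfolding arrivals_def by (intro measure_pmf.prob_space_distr) auto
qed (auto simp: arrivals_def)

lemma integral_arrivals:
  fixes g :: "case_type \<Rightarrow> real"
  shows "(\<integral>x. g x \<partial>arrivals) = g high_case / 4 + 3 * g low_case / 4"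
  unfolding arrivals_def by (subst integral_distr) auto

lemma valid_arrivals_instance: "valid_arrivals 1 arrivals (\<lambda>_. 1 / 2)"
proof -
  have fin: "finite_prob_space arrivals" by (rule finite_prob_space_arrivals)
  then have "snd \<in> measurable arrivals (count_space UNIV)"
    by (auto simp: finite_prob_space_def intro!: measurableI)
  moreover have "AE a in arrivals. (\<forall>i\<in>{1..1}. 0 \<le> fst a i \<and> fst a i \<le> 1) \<and> snd a \<le> 1"
    by (intro AE_I2) (auto simp: space_arrivals low_case_def high_case_def)
  moreover have "{a \<in> space arrivals. snd a = 1} = {}"
    by (auto simp: space_arrivals low_case_def high_case_def)
  then have "measure arrivals {a \<in> space arrivals. snd a = 1} = 0" by (simp only: measure_empty)
  ultimately show ?thesis
    unfolding valid_arrivals_def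
    using fin by (auto simp: finite_prob_space_def finite_prob_space_measurable intro!: exI[of _ "1 / 2"])
qed

definition arrival_paths :: "nat \<Rightarrow> (nat \<Rightarrow> case_type) measure" where
  "arrival_paths T = PiM {1..T} (\<lambda>_. arrivals)"

lemma finite_prob_space_arrival_paths [simp]: "finite_prob_space (arrival_paths T)"
  unfolding arrival_paths_def by (intro finite_prob_space_PiM finite_prob_space_arrivals) simp

lemma measure_space_1: "finite_prob_space M \<Longrightarrow> measure M (space M) = 1"
  by (simp add: finite_prob_space_def prob_space.prob_space)

lemma arrival_centered:
  assumes "t \<in> {1..T}"
    and "\<And>a y. a \<in> space (arrival_paths T) \<Longrightarrow> y \<in> space arrivals \<Longrightarrow> f (a(t := y)) = f a"
  shows "(\<integral>a. f a * (is_high (a t) - 1 / 4) \<partial>arrival_paths T) = 0"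
  using assms finite_prob_space_arrivals unfolding arrival_paths_def
  by (subst integral_PiM_mult_coord[where g = "\<lambda>y. is_high y - 1 / 4"]) (auto simp: integral_arrivals)

lemma space_arrival_paths:
  "a \<in> space (arrival_paths T) \<Longrightarrow> t \<in> {1..T} \<Longrightarrow> a t \<in> {low_case, high_case}"
  unfolding arrival_paths_def space_PiM space_arrivals by (rule PiE_mem)

text \<open>At \<open>v 1 = 0\<close> both decisions are maximizers, hence the strict inequalities
  in \<open>accept\<close> and \<open>reject\<close>.\<close>

lemma argmax_rule_single:
  assumes "argmax_rule 1 \<sigma>"
  shows "\<sigma> t v 1 \<in> {0, 1}" "0 < v 1 \<Longrightarrow> \<sigma> t v 1 = 1" "v 1 < 0 \<Longrightarrow> \<sigma> t v 1 = 0"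
proof -
  have *: "is_arg_max (\<lambda>z. v 1 * z 1) (\<lambda>z. z \<in> alloc_simplex 1 \<and> (\<forall>i. z i \<in> {0, 1})) (\<sigma> t v)"
    using assms by (simp add: argmax_rule_def)
  then show 01: "\<sigma> t v 1 \<in> {0, 1}" by (auto simp: is_arg_max_def)
  have le: "v 1 * z 1 \<le> v 1 * \<sigma> t v 1" if "z \<in> alloc_simplex 1" "\<forall>i. z i \<in> {0, 1}" for z
    using * that by (auto simp: is_arg_max_def not_less)
  have "v 1 \<le> v 1 * \<sigma> t v 1"
    using le[of "unit_vec 1"] by (auto simp: unit_vec_def alloc_simplex_def)
  moreover have "0 \<le> v 1 * \<sigma> t v 1"
    using le[of "\<lambda>_. 0"] by (auto simp: alloc_simplex_def)
  ultimately show "0 < v 1 \<Longrightarrow> \<sigma> t v 1 = 1" "v 1 < 0 \<Longrightarrow> \<sigma> t v 1 = 0"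
    using 01 by auto
qed

lemma codl_state_cong:
  assumes "\<And>t. 1 \<le> t \<Longrightarrow> t \<le> n \<Longrightarrow> a t = a' t"
  shows "codl_state m T \<rho> k \<alpha> \<sigma> a n = codl_state m T \<rho> k \<alpha> \<sigma> a' n"
  using assms by (induction n) (auto simp: Let_def)

abbreviation half_state ::
  "nat \<Rightarrow> real \<Rightarrow> real \<Rightarrow> (nat \<Rightarrow> (nat \<Rightarrow> real) \<Rightarrow> nat \<Rightarrow> real) \<Rightarrow> (nat \<Rightarrow> case_type) \<Rightarrow> nat \<Rightarrow>
     (nat \<Rightarrow> real) \<times> (nat \<Rightarrow> real) \<times> (nat \<Rightarrow> real)" where
  "half_state T k \<alpha> \<sigma> a \<equiv> codl_state 1 T (\<lambda>_. 1 / 2) k \<alpha> \<sigma> a"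

abbreviation half_alloc ::
  "nat \<Rightarrow> real \<Rightarrow> real \<Rightarrow> (nat \<Rightarrow> (nat \<Rightarrow> real) \<Rightarrow> nat \<Rightarrow> real) \<Rightarrow> (nat \<Rightarrow> case_type) \<Rightarrow> nat \<Rightarrow> nat \<Rightarrow> real" where
  "half_alloc T k \<alpha> \<sigma> a \<equiv> codl_alloc 1 T (\<lambda>_. 1 / 2) k \<alpha> \<sigma> a"

lemma dual_path_codl:
  assumes k: "0 < k" "0 \<le> \<alpha>" and \<sigma>: "argmax_rule 1 \<sigma>"
    and a: "\<And>t. t \<in> {1..T} \<Longrightarrow> a t \<in> {low_case, high_case}"
  shows "dual_path k \<alpha> T (\<lambda>n. fst (a (Suc n)) 1) (\<lambda>n. half_alloc T k \<alpha> \<sigma> a (Suc n) 1)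
    (\<lambda>n. fst (half_state T k \<alpha> \<sigma> a n) 1) (\<lambda>n. fst (snd (half_state T k \<alpha> \<sigma> a n)) 1)
    (\<lambda>n. snd (snd (half_state T k \<alpha> \<sigma> a n)) 1)"
proof -
  have free: "snd (a (Suc n)) = 0" if "n < T" for n
    using a[of "Suc n"] that by (auto simp: low_case_def high_case_def)
  note defs = codl_alloc_def codl_decision_def case_prod_beta
  show ?thesis
  proof
    fix n assume n: "n < T"
    show "half_alloc T k \<alpha> \<sigma> a (Suc n) 1 \<in> {0, 1}"
      using argmax_rule_single(1)[OF \<sigma>] free[OF n] by (auto simp: defs)
    show "fst (a (Suc n)) 1 \<in> {1 / 10, 7 / 10}"
      using a[of "Suc n"] n by (auto simp: low_case_def high_case_def)
    show "fst (half_state T k \<alpha> \<sigma> a n) 1 \<le> 0 \<Longrightarrow> half_alloc T k \<alpha> \<sigma> a (Suc n) 1 = 0"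
      using free[OF n] by (auto simp: defs)
    show "0 < fst (half_state T k \<alpha> \<sigma> a n) 1 \<Longrightarrow>
      fst (snd (half_state T k \<alpha> \<sigma> a n)) 1 + snd (snd (half_state T k \<alpha> \<sigma> a n)) 1 < fst (a (Suc n)) 1 \<Longrightarrow>
      half_alloc T k \<alpha> \<sigma> a (Suc n) 1 = 1"
      using free[OF n] by (auto simp: defs intro!: argmax_rule_single(2)[OF \<sigma>, simplified])
    show "fst (a (Suc n)) 1 < fst (snd (half_state T k \<alpha> \<sigma> a n)) 1 + snd (snd (half_state T k \<alpha> \<sigma> a n)) 1 \<Longrightarrow>
      half_alloc T k \<alpha> \<sigma> a (Suc n) 1 = 0"
      using free[OF n] by (auto simp: defs intro!: argmax_rule_single(3)[OF \<sigma>, simplified])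
  qed (use k in \<open>auto simp: Let_def case_prod_beta codl_alloc_def\<close>)
qed

section \<open>Expected surplus of CO-DL over the rate 1 / 2\<close>

lemma harm_le: "1 \<le> N \<Longrightarrow> (harm N :: real) \<le> 1 + ln (real N)"
  using decseqD[OF decseq_harm_diff_ln, of 0 "N - 1"] by (simp add: harm_expand)

text \<open>\<open>V n\<close> depends only on the arrivals before period \<open>n + 1\<close>, so
  in expectation the indicator in \<open>sum_V_le\<close> becomes 1 / 4 and the weighted sum of
  \<open>V\<close> is O(ln N). Half of 1 / 512 covers this sum, the other half the shortfall of the
  last dual.\<close>

lemma expected_surplus:
  assumes k: "0 < k" "0 \<le> \<alpha>" and \<sigma>: "argmax_rule 1 \<sigma>"
  obtains N0 where "\<And>N T. N0 \<le> N \<Longrightarrow> N \<le> T \<Longrightarrow>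
    - (1 / 512) * sqrt (real N) \<le>
      (\<integral>a. (\<Sum>t=1..N. half_alloc T k \<alpha> \<sigma> a t 1 - 1 / 2) \<partial>arrival_paths T)"
proof -
  obtain N1 where N1: "\<And>\<alpha> T w z cc th la N. dual_path k \<alpha> T w z cc th la \<Longrightarrow> N1 \<le> N \<Longrightarrow> N \<le> T \<Longrightarrow>
    - (k / 1024) * sqrt (real N) - (\<Sum>n<N. dual_path.V th la n / sqrt (real (Suc n))) \<le> k * (\<Sum>n<N. z n - 1 / 2)"
    by (rule dual_path_surplus[OF k(1), of "k / 1024"]) (use k in auto)
  have "eventually (\<lambda>N. (18 + 2 * k\<^sup>2 * (1 + ln (real N))) / k \<le> k / 1024 * sqrt (real N)) sequentially"
    using k by real_asymp
  then obtain N2 where N2: "\<And>N. N2 \<le> N \<Longrightarrow> (18 + 2 * k\<^sup>2 * (1 + ln (real N))) / k \<le> k / 1024 * sqrt (real N)"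
    by (auto simp: eventually_sequentially)
  show thesis
  proof (rule that[of "max 1 (max N1 N2)"])
    fix N T assume N: "max 1 (max N1 N2) \<le> N" "N \<le> T"
    let ?P = "arrival_paths T"
    let ?th = "\<lambda>a n. fst (snd (half_state T k \<alpha> \<sigma> a n)) 1" and ?la = "\<lambda>a n. snd (snd (half_state T k \<alpha> \<sigma> a n)) 1"
    define V where "V n a = dual_path.V (?th a) (?la a) n" for n a
    have fin: "finite_prob_space ?P" by simp
    interpret prob_space ?P using fin by (simp add: finite_prob_space_def)
    have int [simp]: "integrable ?P f" for f :: "_ \<Rightarrow> real" using fin by simp
    have path: "dual_path k \<alpha> T (\<lambda>n. fst (a (Suc n)) 1) (\<lambda>n. half_alloc T k \<alpha> \<sigma> a (Suc n) 1)
      (\<lambda>n. fst (half_state T k \<alpha> \<sigma> a n) 1) (?th a) (?la a)" if "a \<in> space ?P" for a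
      using space_arrival_paths[OF that] by (intro dual_path_codl k \<sigma>) auto
    define c where "c n = k / sqrt (real (Suc n))" for n
    have V_cong: "V n (a(Suc n := y)) = V n a" if "a \<in> space ?P" "y \<in> space arrivals" "n < T" for n a y
    proof -
      \<comment> \<open>The equation \<open>dual_path.V_def\<close> is conditional on the locale
        predicate, which is therefore established for the modified path too.\<close>
      have "a(Suc n := y) \<in> space ?P"
        using that by (auto simp: arrival_paths_def space_PiM PiE_iff extensional_def)
      note * = path[OF this] path[OF that(1)]
      have "half_state T k \<alpha> \<sigma> (a(Suc n := y)) n = half_state T k \<alpha> \<sigma> a n"
        by (rule codl_state_cong) auto
      then show ?thesis
        unfolding V_def *[THEN dual_path.V_def] *[THEN dual_path.u_def] by simp
    qed
    have ind: "expectation (\<lambda>a. V n a * (1 / 2 - is_high (a (Suc n)))) = expectation (V n) / 4" if "n < T" for n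
    proof -
      have "expectation (\<lambda>a. V n a * (is_high (a (Suc n)) - 1 / 4)) = 0"
        using that V_cong by (intro arrival_centered) auto
      moreover have "expectation (\<lambda>a. V n a * (1 / 2 - is_high (a (Suc n)))) =
        expectation (\<lambda>a. V n a / 4 - V n a * (is_high (a (Suc n)) - 1 / 4))"
        by (intro Bochner_Integration.integral_cong refl) (simp add: algebra_simps)
      ultimately show ?thesis by simp
    qed
    have "expectation (\<lambda>a. \<Sum>n<N. 2 * c n * (V n a * (1 / 2 - is_high (a (Suc n)))))
      \<le> expectation (\<lambda>a. 9 + (\<Sum>n<N. (c n)\<^sup>2))"
    proof (rule integral_mono)
      fix a assume "a \<in> space ?P"
      from dual_path.sum_V_le[OF path[OF this] N(2)]
      show "(\<Sum>n<N. 2 * c n * (V n a * (1 / 2 - is_high (a (Suc n))))) \<le> 9 + (\<Sum>n<N. (c n)\<^sup>2)"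
        by (simp add: V_def c_def is_high_def)
    qed (rule int)+
    also have "expectation (\<lambda>a. 9 + (\<Sum>n<N. (c n)\<^sup>2)) = 9 + (\<Sum>n<N. (c n)\<^sup>2)"
      by (simp add: prob_space del: One_nat_def)
    also have "(\<Sum>n<N. (c n)\<^sup>2) = k\<^sup>2 * harm N"
      unfolding c_def power_divide by (simp add: harm_altdef sum_distrib_left divide_inverse)
    also have "expectation (\<lambda>a. \<Sum>n<N. 2 * c n * (V n a * (1 / 2 - is_high (a (Suc n)))))
      = (\<Sum>n<N. 2 * c n * expectation (\<lambda>a. V n a * (1 / 2 - is_high (a (Suc n)))))"
      by simp
    also have "\<dots> = (\<Sum>n<N. 2 * c n * (expectation (V n) / 4))"
    proof (rule sum.cong[OF refl])
      fix n assume "n \<in> {..<N}"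
      then have "n < T" using N(2) by simp
      show "2 * c n * expectation (\<lambda>a. V n a * (1 / 2 - is_high (a (Suc n)))) = 2 * c n * (expectation (V n) / 4)"
        unfolding ind[OF \<open>n < T\<close>] ..
    qed
    also have "\<dots> = k / 2 * (\<Sum>n<N. expectation (V n) / sqrt (real (Suc n)))"
      by (simp add: c_def sum_distrib_left mult.commute)
    finally have "k / 2 * (\<Sum>n<N. expectation (V n) / sqrt (real (Suc n))) \<le> 9 + k\<^sup>2 * (1 + ln (real N))"
      using harm_le[of N] N mult_left_mono[of "harm N" "1 + ln (real N)" "k\<^sup>2"] by simp
    then have sumV: "(\<Sum>n<N. expectation (V n) / sqrt (real (Suc n))) \<le> (18 + 2 * k\<^sup>2 * (1 + ln (real N))) / k"
      using k by (simp add: field_simps)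
    have "expectation (\<lambda>a. - (k / 1024) * sqrt (real N) - (\<Sum>n<N. V n a / sqrt (real (Suc n))))
      \<le> expectation (\<lambda>a. k * (\<Sum>n<N. half_alloc T k \<alpha> \<sigma> a (Suc n) 1 - 1 / 2))"
      using N N1[OF path] by (intro integral_mono) (auto simp: V_def)
    then have "- (k / 1024) * sqrt (real N) - (\<Sum>n<N. expectation (V n) / sqrt (real (Suc n)))
      \<le> k * expectation (\<lambda>a. (\<Sum>n<N. half_alloc T k \<alpha> \<sigma> a (Suc n) 1 - 1 / 2))"
      by (simp add: Bochner_Integration.integral_sum prob_space del: sum_subtractf One_nat_def)
    with sumV N2[of N] N have "k * (- (1 / 512) * sqrt (real N))
      \<le> k * expectation (\<lambda>a. (\<Sum>n<N. half_alloc T k \<alpha> \<sigma> a (Suc n) 1 - 1 / 2))"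
      by linarith
    then have "- (1 / 512) * sqrt (real N) \<le> expectation (\<lambda>a. (\<Sum>n<N. half_alloc T k \<alpha> \<sigma> a (Suc n) 1 - 1 / 2))"
      using k by (simp only: mult_le_cancel_left_pos)
    moreover have "(\<Sum>n<N. half_alloc T k \<alpha> \<sigma> a (Suc n) 1 - 1 / 2) = (\<Sum>t=1..N. half_alloc T k \<alpha> \<sigma> a t 1 - 1 / 2)" for a
      by (simp add: sum.atLeast1_atMost_eq del: sum_subtractf)
    ultimately show "- (1 / 512) * sqrt (real N) \<le>
      (\<integral>a. (\<Sum>t=1..N. half_alloc T k \<alpha> \<sigma> a t 1 - 1 / 2) \<partial>?P)" by (simp only:)
  qed
qed

section \<open>Moments and queues\<close>

definition services :: "nat \<Rightarrow> real \<Rightarrow> (nat \<times> nat \<Rightarrow> bool) measure" where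
  "services T r = PiM ({1..T} \<times> {1..1}) (\<lambda>_. measure_pmf (bernoulli_pmf r))"

lemma finite_prob_space_bernoulli: "finite_prob_space (measure_pmf (bernoulli_pmf r))"
  by (simp add: finite_prob_space_def measure_pmf.prob_space_axioms)

lemma finite_prob_space_services [simp]: "finite_prob_space (services T r)"
  unfolding services_def by (intro finite_prob_space_PiM finite_prob_space_bernoulli) simp

lemma sample_space_eq: "sample_space 1 T arrivals (\<lambda>_. r) = arrival_paths T \<Otimes>\<^sub>M services T r"
  by (simp add: sample_space_def arrival_paths_def services_def)

lemma service_centered:
  assumes "t \<in> {1..T}" "0 \<le> r" "r \<le> 1" "\<And>s y. f (s((t, 1) := y)) = f s"
  shows "(\<integral>s. f s * (of_bool (s (t, 1)) - r) \<partial>services T r) = 0"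
proof -
  have "(\<integral>y. of_bool y - r \<partial>measure_pmf (bernoulli_pmf r)) = 0"
    using assms by (simp add: algebra_simps)
  then show ?thesis
    unfolding services_def
    using assms finite_prob_space_bernoulli
    by (subst integral_PiM_mult_coord[where g = "\<lambda>y. of_bool y - r"]) auto
qed

lemma service_moments:
  assumes "A \<subseteq> {1..T}" "0 \<le> r" "r \<le> 1"
  shows "(\<integral>s. (\<Sum>t\<in>A. r - of_bool (s (t, 1))) \<partial>services T r) = 0"
    and "(\<integral>s. (\<Sum>t\<in>A. r - of_bool (s (t, 1)))\<^sup>2 \<partial>services T r) = real (card A) * (r * (1 - r))"
    and "(\<integral>s. (\<Sum>t\<in>A. r - of_bool (s (t, 1))) ^ 4 \<partial>services T r) \<le> 3 * (real (card A))\<^sup>2"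
proof -
  define J where "J = (\<lambda>t. (t, 1 :: nat)) ` A"
  have inj: "inj_on (\<lambda>t. (t, 1 :: nat)) A" by (auto intro: inj_onI)
  have card: "card J = card A" unfolding J_def by (rule card_image[OF inj])
  have sum: "(\<Sum>ti\<in>J. r - of_bool (s ti)) = (\<Sum>t\<in>A. r - of_bool (s (t, 1)))" for s :: "nat \<times> nat \<Rightarrow> bool"
    unfolding J_def by (subst sum.reindex[OF inj]) simp
  have J: "J \<subseteq> {1..T} \<times> {1..1}" using assms by (auto simp: J_def)
  have mean: "(\<integral>y. r - of_bool y \<partial>measure_pmf (bernoulli_pmf r)) = 0"
    using assms by (simp add: algebra_simps)
  have var: "(\<integral>y. (r - of_bool y)\<^sup>2 \<partial>measure_pmf (bernoulli_pmf r)) = r * (1 - r)"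
    using assms by (simp add: power2_eq_square algebra_simps)
  have bound: "\<bar>r - of_bool y\<bar> \<le> 1" for y using assms by (cases y) auto
  note * = centered_sum_moments[where \<xi> = "\<lambda>_ y. r - of_bool y", OF _ finite_prob_space_bernoulli J mean var bound]
  show "(\<integral>s. (\<Sum>t\<in>A. r - of_bool (s (t, 1))) \<partial>services T r) = 0"
    "(\<integral>s. (\<Sum>t\<in>A. r - of_bool (s (t, 1)))\<^sup>2 \<partial>services T r) = real (card A) * (r * (1 - r))"
    "(\<integral>s. (\<Sum>t\<in>A. r - of_bool (s (t, 1))) ^ 4 \<partial>services T r) \<le> 3 * (real (card A))\<^sup>2"
    using * unfolding services_def[symmetric] sum card by simp_all
qed

lemma arrival_variance:
  assumes "A \<subseteq> {1..T}"
  shows "(\<integral>a. (\<Sum>t\<in>A. is_high (a t) - 1 / 4)\<^sup>2 \<partial>arrival_paths T) = real (card A) * (3 / 16)"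
  unfolding arrival_paths_def
proof (rule centered_sum_moments(2)[where \<xi> = "\<lambda>_ y. is_high y - 1 / 4"])
  show "\<bar>is_high y - 1 / 4\<bar> \<le> 1" for y using is_high_01[of y] by auto
qed (use assms finite_prob_space_arrivals in \<open>auto simp: integral_arrivals power2_eq_square\<close>)

text \<open>The second moment is split at \<open>K\<close>: x^2 \<le> K |x| below, x^2 \<le> x^4 /
  K^2 above. With K = 6 sqrt t the fourth moment takes 1 / 12 of the 3 / 16, so the mean absolute
  value is at least (5 / 288) sqrt t; centering makes the positive part half of it, and 5 / 576
  \<ge> 1 / 128.\<close>

lemma positive_part_moment:
  assumes M: "finite_prob_space M" and t: "0 < t"
    and N: "(\<integral>x. N x \<partial>M) = 0" "3 * t / 16 \<le> (\<integral>x. (N x)\<^sup>2 \<partial>M)" "(\<integral>x. (N x) ^ 4 \<partial>M) \<le> 3 * t\<^sup>2"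
  shows "sqrt t / 128 \<le> (\<integral>x. max 0 (N x) \<partial>M)"
proof -
  have int [simp]: "integrable M f" for f :: "_ \<Rightarrow> real" using M by simp
  define K where "K = 6 * sqrt t"
  have K: "0 < K" "K\<^sup>2 = 36 * t" using t by (auto simp: K_def power_mult_distrib)
  have *: "x\<^sup>2 \<le> K * \<bar>x\<bar> + x ^ 4 / K\<^sup>2" for x :: real
  proof (cases "\<bar>x\<bar> \<le> K")
    case True
    have "x\<^sup>2 = \<bar>x\<bar> * \<bar>x\<bar>" by (simp add: power2_eq_square)
    also have "\<dots> \<le> K * \<bar>x\<bar>" using True by (intro mult_right_mono) auto
    also have "\<dots> \<le> K * \<bar>x\<bar> + x ^ 4 / K\<^sup>2" by simp
    finally show ?thesis .
  next
    case False
    then have "K\<^sup>2 \<le> \<bar>x\<bar>\<^sup>2" using K by (intro power_mono) auto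
    then have "K\<^sup>2 * x\<^sup>2 \<le> x\<^sup>2 * x\<^sup>2" by (intro mult_right_mono) auto
    moreover have "x\<^sup>2 * x\<^sup>2 = x ^ 4" by (simp flip: power_add)
    ultimately have "x\<^sup>2 * K\<^sup>2 \<le> x ^ 4" by (simp add: mult.commute)
    moreover have "0 < K\<^sup>2" using K(1) by simp
    ultimately have "x\<^sup>2 \<le> x ^ 4 / K\<^sup>2" by (simp only: pos_le_divide_eq)
    moreover have "0 \<le> K * \<bar>x\<bar>" using K by simp
    ultimately show ?thesis by linarith
  qed
  have "(\<integral>x. (N x)\<^sup>2 \<partial>M) \<le> (\<integral>x. K * \<bar>N x\<bar> + (N x) ^ 4 / K\<^sup>2 \<partial>M)"
    using * by (intro integral_mono) auto
  also have "\<dots> = K * (\<integral>x. \<bar>N x\<bar> \<partial>M) + (\<integral>x. (N x) ^ 4 \<partial>M) / K\<^sup>2" by simp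
  also have "(\<integral>x. (N x) ^ 4 \<partial>M) / K\<^sup>2 \<le> 3 * t\<^sup>2 / K\<^sup>2" using N by (intro divide_right_mono) auto
  also have "3 * t\<^sup>2 / K\<^sup>2 = t / 12" unfolding K(2) using t by (simp add: power2_eq_square)
  finally have "5 * t / 48 \<le> K * (\<integral>x. \<bar>N x\<bar> \<partial>M)" using N(2) by simp
  moreover have "5 * t / 48 = sqrt t * (5 / 48 * sqrt t)" using t by (simp add: mult.left_commute)
  ultimately have "sqrt t * (5 / 48 * sqrt t) \<le> sqrt t * (6 * (\<integral>x. \<bar>N x\<bar> \<partial>M))"
    by (simp only: K_def mult_ac)
  then have abs: "5 / 48 * sqrt t \<le> 6 * (\<integral>x. \<bar>N x\<bar> \<partial>M)"
    using t by (simp only: mult_le_cancel_left_pos real_sqrt_gt_zero)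
  have "max 0 x = (\<bar>x\<bar> + x) / 2" for x :: real by (simp add: max_def)
  then have "(\<integral>x. max 0 (N x) \<partial>M) = (\<integral>x. (\<bar>N x\<bar> + N x) / 2 \<partial>M)" by (simp only:)
  also have "\<dots> = (\<integral>x. \<bar>N x\<bar> \<partial>M) / 2" using N(1) by simp
  finally have "(\<integral>x. max 0 (N x) \<partial>M) = (\<integral>x. \<bar>N x\<bar> \<partial>M) / 2" .
  then show ?thesis using abs real_sqrt_ge_zero[of t] t by linarith
qed

text \<open>Pointwise, (A + N)_+ is at least N_+ plus \<open>A\<close> on the event
  \<open>N > 0\<close>. By independence that last term contributes the mean of \<open>A\<close>
  times a probability, so nothing about \<open>A\<close> beyond its mean enters.\<close>

lemma positive_part_independent:
  fixes A :: "'a \<Rightarrow> real" and N :: "'b \<Rightarrow> real"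
  assumes M: "finite_prob_space M" "finite_prob_space M'" and A: "- x \<le> (\<integral>a. A a \<partial>M)" "0 \<le> x"
  shows "(\<integral>s. max 0 (N s) \<partial>M') - x \<le> (\<integral>\<omega>. max 0 (A (fst \<omega>) + N (snd \<omega>)) \<partial>(M \<Otimes>\<^sub>M M'))"
proof -
  note [simp] = finite_prob_space_integrable[OF finite_prob_space_pair[OF M]] finite_prob_space_integrable[OF M(1)]
    finite_prob_space_integrable[OF M(2)] measure_space_1[OF M(1)] measure_space_1[OF M(2)]
  define p :: real where "p = (\<integral>s. of_bool (0 < N s) \<partial>M')"
  have "0 \<le> p" unfolding p_def by (intro Bochner_Integration.integral_nonneg) auto
  have "p \<le> (\<integral>s. 1 \<partial>M')" unfolding p_def by (intro integral_mono) auto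
  then have "p \<le> 1" by simp
  have "(\<integral>s. max 0 (N s) \<partial>M') + p * (\<integral>a. A a \<partial>M) =
    (\<integral>\<omega>. max 0 (N (snd \<omega>)) + of_bool (0 < N (snd \<omega>)) * A (fst \<omega>) \<partial>(M \<Otimes>\<^sub>M M'))"
    using finite_prob_space_integral_pair(1)[OF M, of "\<lambda>\<omega>. max 0 (N (snd \<omega>))"]
      finite_prob_space_integral_pair(1)[OF M, of "\<lambda>\<omega>. of_bool (0 < N (snd \<omega>)) * A (fst \<omega>)"]
    by (simp add: p_def)
  also have "\<dots> \<le> (\<integral>\<omega>. max 0 (A (fst \<omega>) + N (snd \<omega>)) \<partial>(M \<Otimes>\<^sub>M M'))"
    by (intro integral_mono) (auto simp: max_def)
  finally have "(\<integral>s. max 0 (N s) \<partial>M') + p * (\<integral>a. A a \<partial>M) \<le> \<dots>" .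
  moreover have "p * (- x) \<le> p * (\<integral>a. A a \<partial>M)" using \<open>0 \<le> p\<close> A by (intro mult_left_mono)
  moreover have "p * x \<le> x" using \<open>p \<le> 1\<close> \<open>0 \<le> p\<close> A by (simp add: mult_left_le_one_le)
  ultimately show ?thesis by simp
qed

section \<open>Queue of the high cases\<close>

definition high_queue :: "(nat \<Rightarrow> case_type) \<Rightarrow> (nat \<times> nat \<Rightarrow> bool) \<Rightarrow> nat \<Rightarrow> real" where
  "high_queue a s t = backlog (single_alloc (\<lambda>t. is_high (a t))) s t 1"

lemma high_queue_simps:
  "high_queue a s 0 = 0"
  "high_queue a s (Suc t) = max 0 (high_queue a s t + is_high (a (Suc t)) - of_bool (s (Suc t, 1)))"
  by (simp_all add: high_queue_def)

lemma high_queue_nonneg: "0 \<le> high_queue a s t"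
  by (simp add: high_queue_def)

lemma high_queue_le: "high_queue a s t \<le> real t"
proof (induction t)
  case (Suc t)
  then show ?case using is_high_01[of "a (Suc t)"] by (auto simp: high_queue_simps)
qed (simp add: high_queue_simps)

lemma high_queue_cong_arrival: "n < t \<Longrightarrow> high_queue (a(t := y)) s n = high_queue a s n"
  by (induction n) (auto simp: high_queue_simps)

lemma high_queue_cong_service: "n < t \<Longrightarrow> high_queue a (s((t, 1) := y)) n = high_queue a s n"
  by (induction n) (auto simp: high_queue_simps)

text \<open>Truncation at 0 only lowers the square of the queue, and each increment has square at
  most 1.\<close>

lemma high_queue_drift:
  "(high_queue a s N)\<^sup>2 + (\<Sum>n<N. 2 * (high_queue a s n * (of_bool (s (Suc n, 1)) - is_high (a (Suc n))))) \<le> real N"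
proof (induction N)
  case (Suc N)
  let ?q = "high_queue a s N" and ?d = "is_high (a (Suc N)) - of_bool (s (Suc N, 1))"
  have "?d\<^sup>2 \<le> 1" using is_high_01[of "a (Suc N)"] by auto
  have "(high_queue a s (Suc N))\<^sup>2 \<le> (?q + ?d)\<^sup>2"
    unfolding high_queue_simps max_def by auto
  also have "\<dots> = ?q\<^sup>2 + 2 * (?q * ?d) + ?d\<^sup>2" by (simp add: power2_sum)
  also have "\<dots> \<le> ?q\<^sup>2 + 2 * (?q * ?d) + 1" using \<open>?d\<^sup>2 \<le> 1\<close> by simp
  also have "?q * ?d = - (?q * (of_bool (s (Suc N, 1)) - is_high (a (Suc N))))"
    by (simp add: algebra_simps)
  finally show ?case using Suc by simp
qed (simp add: high_queue_simps)

text \<open>High cases arrive at rate 1 / 4 and are served at rate at least 1 / 2. The drift gives 2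
  T for the queues at times 0 to T - 1; moving the sum to 1 to T costs one queue, at most T. After
  the factor \<gamma> / T this is only O(\<gamma>).\<close>

lemma expected_high_queue:
  assumes r: "1 / 2 \<le> r" "r \<le> 1"
  shows "(\<integral>\<omega>. (\<Sum>t=1..T. high_queue (fst \<omega>) (snd \<omega>) t) \<partial>(arrival_paths T \<Otimes>\<^sub>M services T r)) \<le> 3 * real T"
proof -
  let ?P = "arrival_paths T \<Otimes>\<^sub>M services T r"
  have fin: "finite_prob_space ?P" by (intro finite_prob_space_pair) auto
  note [simp] = finite_prob_space_integrable[OF fin] measure_space_1[OF fin]
  let ?q = "\<lambda>\<omega>. high_queue (fst \<omega>) (snd \<omega>)"
  have drift: "(\<integral>\<omega>. ?q \<omega> n * (of_bool (snd \<omega> (Suc n, 1)) - is_high (fst \<omega> (Suc n))) \<partial>?P) =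
    (r - 1 / 4) * (\<integral>\<omega>. ?q \<omega> n \<partial>?P)" if "n < T" for n
  proof -
    have n: "Suc n \<in> {1..T}" using that by simp
    have "(\<integral>s. high_queue a s n * (of_bool (s (Suc n, 1)) - r) \<partial>services T r) = 0" for a
      using n r high_queue_cong_service by (intro service_centered) auto
    then have 1: "(\<integral>\<omega>. ?q \<omega> n * (of_bool (snd \<omega> (Suc n, 1)) - r) \<partial>?P) = 0"
      by (subst finite_prob_space_integral_pair(1)) (simp_all del: One_nat_def)
    have "(\<integral>a. high_queue a s n * (is_high (a (Suc n)) - 1 / 4) \<partial>arrival_paths T) = 0" for s
      using n high_queue_cong_arrival by (intro arrival_centered) auto
    then have 2: "(\<integral>\<omega>. ?q \<omega> n * (is_high (fst \<omega> (Suc n)) - 1 / 4) \<partial>?P) = 0"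
      by (subst finite_prob_space_integral_pair(2)) simp_all
    have "(\<integral>\<omega>. ?q \<omega> n * (of_bool (snd \<omega> (Suc n, 1)) - is_high (fst \<omega> (Suc n))) \<partial>?P) =
      (\<integral>\<omega>. ?q \<omega> n * (of_bool (snd \<omega> (Suc n, 1)) - r) - ?q \<omega> n * (is_high (fst \<omega> (Suc n)) - 1 / 4)
        + (r - 1 / 4) * ?q \<omega> n \<partial>?P)"
      by (intro Bochner_Integration.integral_cong refl) (simp add: algebra_simps)
    then show ?thesis using 1 2 by simp
  qed
  have "(\<integral>\<omega>. (?q \<omega> T)\<^sup>2 + (\<Sum>n<T. 2 * (?q \<omega> n * (of_bool (snd \<omega> (Suc n, 1)) - is_high (fst \<omega> (Suc n))))) \<partial>?P)
    \<le> (\<integral>\<omega>. real T \<partial>?P)"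
    using high_queue_drift by (intro integral_mono) auto
  then have "(\<integral>\<omega>. (?q \<omega> T)\<^sup>2 \<partial>?P) + (\<Sum>n<T. 2 * ((r - 1 / 4) * (\<integral>\<omega>. ?q \<omega> n \<partial>?P))) \<le> real T"
    using drift by simp
  moreover have "0 \<le> (\<integral>\<omega>. (?q \<omega> T)\<^sup>2 \<partial>?P)" by (intro Bochner_Integration.integral_nonneg) auto
  moreover have "(\<Sum>n<T. 1 / 2 * (\<integral>\<omega>. ?q \<omega> n \<partial>?P)) \<le> (\<Sum>n<T. 2 * ((r - 1 / 4) * (\<integral>\<omega>. ?q \<omega> n \<partial>?P)))"
  proof (rule sum_mono)
    fix n
    have "0 \<le> (\<integral>\<omega>. ?q \<omega> n \<partial>?P)" by (intro Bochner_Integration.integral_nonneg) (auto simp: high_queue_nonneg)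
    then have "1 / 4 * (\<integral>\<omega>. ?q \<omega> n \<partial>?P) \<le> (r - 1 / 4) * (\<integral>\<omega>. ?q \<omega> n \<partial>?P)"
      using r by (intro mult_right_mono) auto
    then show "1 / 2 * (\<integral>\<omega>. ?q \<omega> n \<partial>?P) \<le> 2 * ((r - 1 / 4) * (\<integral>\<omega>. ?q \<omega> n \<partial>?P))" by simp
  qed
  ultimately have "(\<Sum>n<T. 1 / 2 * (\<integral>\<omega>. ?q \<omega> n \<partial>?P)) \<le> real T" by linarith
  then have sum: "(\<Sum>n<T. (\<integral>\<omega>. ?q \<omega> n \<partial>?P)) \<le> 2 * real T"
    by (simp flip: sum_divide_distrib)
  have "(\<integral>\<omega>. (\<Sum>t=1..T. ?q \<omega> t) \<partial>?P) \<le> (\<integral>\<omega>. (\<Sum>n<T. ?q \<omega> n) + real T \<partial>?P)"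
  proof (intro integral_mono)
    fix \<omega> :: "(nat \<Rightarrow> case_type) \<times> (nat \<times> nat \<Rightarrow> bool)"
    have "(\<Sum>t=1..T. ?q \<omega> t) = (\<Sum>n<Suc T. ?q \<omega> n)"
      unfolding sum.lessThan_Suc_shift by (simp add: sum.atLeast1_atMost_eq high_queue_simps(1))
    then show "(\<Sum>t=1..T. ?q \<omega> t) \<le> (\<Sum>n<T. ?q \<omega> n) + real T" using high_queue_le by simp
  qed auto
  then show ?thesis using sum by simp
qed

section \<open>Pathwise bounds on the optimum and the algorithm\<close>

lemma OPT_ge_backlog:
  assumes "0 \<le> \<alpha>" "0 \<le> \<gamma>" "0 \<le> c 1"
    and a: "\<And>t. t \<in> {1..T} \<Longrightarrow> a t \<in> {low_case, high_case}"
    and x: "\<And>t. 0 \<le> x t" "\<And>t. x t \<le> 1" "(\<Sum>t=1..T. x t) \<le> c 1"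
  shows "(\<Sum>t=1..T. fst (a t) 1 * x t) - \<gamma> / real T * (\<Sum>t=1..T. backlog (single_alloc x) s t 1)
    \<le> OPT 1 T c \<alpha> \<gamma> a s"
proof -
  have free: "snd (a t) = 0" and w: "0 \<le> fst (a t) 1" "fst (a t) 1 \<le> 1" if "t \<in> {1..T}" for t
    using a[OF that] by (auto simp: low_case_def high_case_def)
  let ?z = "single_alloc x" and ?S = "{objective 1 T c \<alpha> \<gamma> a z b | z b. OPT_feasible 1 T c a s z b}"
  have "OPT_feasible 1 T c a s ?z (backlog ?z s)"
    unfolding OPT_feasible_def
  proof (intro conjI ballI)
    fix t assume t: "t \<in> {1..T}"
    show "?z t \<in> feasible_alloc 1 (snd (a t))"
      using x free[OF t] by (auto simp: feasible_alloc_def alloc_simplex_def single_alloc_def)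
    fix i
    show "0 \<le> backlog ?z s t i" by simp
    obtain n where "t = Suc n" using t by (cases t) auto
    then show "backlog ?z s (t - 1) i + ?z t i - of_bool (s (t, i)) \<le> backlog ?z s t i" by simp
  next
    fix i :: nat assume "i \<in> {1..1}"
    then have i: "i = 1" by simp
    have "(\<Sum>t=1..T. of_bool (snd (a t) = 0) * ?z t i) = (\<Sum>t=1..T. x t)"
      using free i by (intro sum.cong) auto
    moreover have "(\<Sum>t=1..T. of_bool (snd (a t) = i) * ?z t i) = 0"
      using free i by (intro sum.neutral) auto
    ultimately show "(\<Sum>t=1..T. of_bool (snd (a t) = 0) * ?z t i)
      \<le> max 0 (c i - (\<Sum>t=1..T. of_bool (snd (a t) = i) * ?z t i))"
      using x(3) i by simp
  qed auto
  then have "objective 1 T c \<alpha> \<gamma> a ?z (backlog ?z s) \<in> ?S" by blast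
  \<comment> \<open>On an unbounded set of reals \<open>Sup\<close> would say nothing; rewards total
    at most \<open>T\<close> and the penalties are nonnegative.\<close>
  moreover have "bdd_above ?S"
  proof (rule bdd_aboveI)
    fix y assume "y \<in> ?S"
    then obtain z b where y: "y = objective 1 T c \<alpha> \<gamma> a z b" and f: "OPT_feasible 1 T c a s z b" by blast
    have "fst (a t) 1 * z t 1 \<le> 1" if t: "t \<in> {1..T}" for t
    proof -
      have "z t \<in> alloc_simplex 1"
        using bspec[OF conjunct1[OF f[unfolded OPT_feasible_def]] t] free[OF t] by (simp add: feasible_alloc_def)
      then have "0 \<le> z t 1" "z t 1 \<le> 1" by (auto simp: alloc_simplex_def)
      then show ?thesis using w[OF t] by (simp add: mult_le_one)
    qed
    then have "(\<Sum>t=1..T. fst (a t) 1 * z t 1) \<le> (\<Sum>t=1..T. 1)" by (rule sum_mono)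
    moreover have "0 \<le> \<gamma> / real T * (\<Sum>t=1..T. b t 1)"
      using f assms(2) by (intro mult_nonneg_nonneg sum_nonneg divide_nonneg_nonneg) (auto simp: OPT_feasible_def)
    moreover have "0 \<le> \<alpha> * max 0 ((\<Sum>t=1..T. z t 1) - c 1)"
      using assms(1) by simp
    ultimately show "y \<le> real T" unfolding y objective_def by simp
  qed
  ultimately have "objective 1 T c \<alpha> \<gamma> a ?z (backlog ?z s) \<le> Sup ?S" by (rule cSup_upper)
  then show ?thesis using x(3) unfolding OPT_def objective_def by simp
qed

lemma first_high_rejected:
  assumes k: "0 < k" "0 \<le> \<alpha>" and \<sigma>: "argmax_rule 1 \<sigma>" and T: "1 \<le> T"
    and a: "\<And>t. t \<in> {1..T} \<Longrightarrow> a t \<in> {low_case, high_case}"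
  shows "is_high (a 1) * half_alloc T k \<alpha> \<sigma> a 1 1 = 0"
proof (cases "is_high (a 1) = 0")
  case False
  then have "fst (a 1) 1 = 7 / 10" by (simp add: is_high_def)
  moreover have "7 / 10 < 2 * exp (- 1 :: real)"
  proof -
    have "7 / 10 * exp 1 < (2 :: real)" using e_less_272 by simp
    then show ?thesis by (simp add: exp_minus field_simps)
  qed
  moreover have "0 < T" using T by simp
  moreover have path: "dual_path k \<alpha> T (\<lambda>n. fst (a (Suc n)) 1) (\<lambda>n. half_alloc T k \<alpha> \<sigma> a (Suc n) 1)
    (\<lambda>n. fst (half_state T k \<alpha> \<sigma> a n) 1) (\<lambda>n. fst (snd (half_state T k \<alpha> \<sigma> a n)) 1)
    (\<lambda>n. snd (snd (half_state T k \<alpha> \<sigma> a n)) 1)"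
    using a by (intro dual_path_codl k \<sigma>)
  ultimately have "half_alloc T k \<alpha> \<sigma> a (Suc 0) 1 = 0"
    using dual_path.reject[OF path, of 0] by simp
  then show ?thesis by simp
qed simp

text \<open>Each allocated case earns 1 / 10 and a high one 6 / 10 more. The allocated high cases
  are bounded both by the total allocation and by the high cases outside period 1.\<close>

lemma ALG_codl_le:
  fixes s :: "nat \<times> nat \<Rightarrow> bool"
  assumes k: "0 < k" "0 \<le> \<alpha>" and \<sigma>: "argmax_rule 1 \<sigma>" and T: "1 \<le> T"
    and a: "\<And>t. t \<in> {1..T} \<Longrightarrow> a t \<in> {low_case, high_case}"
  defines "n \<equiv> (\<Sum>t=1..T. is_high (a t))" and "\<beta> \<equiv> backlog (half_alloc T k \<alpha> \<sigma> a) s"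
  shows "ALG_codl 1 T (\<lambda>_. 1 / 2) k \<sigma> \<alpha> \<gamma> a s + \<gamma> / real T * (\<Sum>t=1..T. \<beta> t 1)
    \<le> 1 / 10 * (real T / 2 + 1) + 6 / 10 * min (real T / 2 + 1) (n - is_high (a 1))"
proof -
  define z where "z t = half_alloc T k \<alpha> \<sigma> a t 1" for t
  have path: "dual_path k \<alpha> T (\<lambda>n. fst (a (Suc n)) 1) (\<lambda>n. half_alloc T k \<alpha> \<sigma> a (Suc n) 1)
    (\<lambda>n. fst (half_state T k \<alpha> \<sigma> a n) 1) (\<lambda>n. fst (snd (half_state T k \<alpha> \<sigma> a n)) 1)
    (\<lambda>n. snd (snd (half_state T k \<alpha> \<sigma> a n)) 1)"
    using a by (intro dual_path_codl k \<sigma>)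
  have z01: "z t \<in> {0, 1}" if "t \<in> {1..T}" for t
  proof -
    have "t - 1 < T" "Suc (t - 1) = t" using that by auto
    then show ?thesis using dual_path.z01[OF path, of "t - 1"] by (simp add: z_def)
  qed
  have "(\<Sum>t=1..T. z t) = (\<Sum>i<T. z (Suc i))" by (simp add: sum.atLeast1_atMost_eq)
  then have Z: "(\<Sum>t=1..T. z t) \<le> real T / 2 + 1"
    using dual_path.total_le[OF path, of T] by (simp add: z_def)
  have w: "fst (a t) 1 * z t = 1 / 10 * z t + 6 / 10 * (is_high (a t) * z t)" if "t \<in> {1..T}" for t
    using a[OF that] by (auto simp: low_case_def high_case_def is_high_def)
  have "(\<Sum>t=1..T. fst (a t) 1 * z t) = (\<Sum>t=1..T. 1 / 10 * z t + 6 / 10 * (is_high (a t) * z t))"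
    using w by (intro sum.cong) auto
  also have "\<dots> = 1 / 10 * (\<Sum>t=1..T. z t) + 6 / 10 * (\<Sum>t=1..T. is_high (a t) * z t)"
    by (simp only: sum.distrib sum_distrib_left)
  finally have rew: "(\<Sum>t=1..T. fst (a t) 1 * z t) = 1 / 10 * (\<Sum>t=1..T. z t) + 6 / 10 * (\<Sum>t=1..T. is_high (a t) * z t)" .
  have hz: "is_high (a t) * z t \<le> z t" "is_high (a t) * z t \<le> is_high (a t)" if "t \<in> {1..T}" for t
    using z01[OF that] is_high_01[of "a t"] by auto
  have "(\<Sum>t=1..T. is_high (a t) * z t) \<le> (\<Sum>t=1..T. z t)" using hz by (intro sum_mono)
  moreover have "(\<Sum>t=1..T. is_high (a t) * z t) \<le> n - is_high (a 1)"
  proof -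
    have "{1..T} = insert 1 {2..T}" using T by auto
    then have split: "(\<Sum>t=1..T. f t) = f 1 + (\<Sum>t=2..T. f t)" for f :: "nat \<Rightarrow> real" by simp
    have "(\<Sum>t=2..T. is_high (a t) * z t) \<le> (\<Sum>t=2..T. is_high (a t))" using hz by (intro sum_mono) auto
    moreover have "is_high (a 1) * z 1 = 0"
      unfolding z_def by (rule first_high_rejected[OF k \<sigma> T a])
    ultimately show ?thesis unfolding n_def split by linarith
  qed
  moreover have "0 \<le> \<alpha> * max 0 ((\<Sum>t=1..T. z t) - real T / 2)" using k by simp
  moreover have "ALG_codl 1 T (\<lambda>_. 1 / 2) k \<sigma> \<alpha> \<gamma> a s = (\<Sum>t=1..T. fst (a t) 1 * z t)
    - \<alpha> * max 0 ((\<Sum>t=1..T. z t) - real T / 2) - \<gamma> / real T * (\<Sum>t=1..T. \<beta> t 1)"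
    by (simp add: ALG_codl_def objective_def z_def \<beta>_def Let_def)
  ultimately have H: "(\<Sum>t=1..T. is_high (a t) * z t) \<le> min (real T / 2 + 1) (n - is_high (a 1))"
    and A: "ALG_codl 1 T (\<lambda>_. 1 / 2) k \<sigma> \<alpha> \<gamma> a s + \<gamma> / real T * (\<Sum>t=1..T. \<beta> t 1)
      \<le> 1 / 10 * (\<Sum>t=1..T. z t) + 6 / 10 * (\<Sum>t=1..T. is_high (a t) * z t)"
    using Z unfolding rew by linarith+
  have "1 / 10 * (\<Sum>t=1..T. z t) + 6 / 10 * (\<Sum>t=1..T. is_high (a t) * z t)
    \<le> 1 / 10 * (real T / 2 + 1) + 6 / 10 * min (real T / 2 + 1) (n - is_high (a 1))"
    by (rule add_mono[OF mult_left_mono[OF Z] mult_left_mono[OF H]]) simp_all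
  with A show ?thesis by (rule order_trans)
qed

text \<open>
  The three summands: the queue of the high cases, the deficit held during the last \<open>W\<close> periods,
  and a fallback for the rare paths without room for the deficit in those periods.
\<close>

definition comparator_cost :: "nat \<Rightarrow> nat \<Rightarrow> real \<Rightarrow> (nat \<Rightarrow> case_type) \<Rightarrow> (nat \<times> nat \<Rightarrow> bool) \<Rightarrow> real" where
  "comparator_cost T W r a s =
     (let d1 = (\<Sum>t\<in>{1..T}. r - of_bool (s (t, 1)));
          d2 = (\<Sum>t\<in>{T-W<..T}. is_high (a t) - 1 / 4);
          d3 = (\<Sum>t\<in>{T-W<..T}. r - of_bool (s (t, 1)))
      in (\<Sum>t=1..T. high_queue a s t) + real W * ((d1\<^sup>2 / sqrt (real T) + sqrt (real T)) / 2)
         + 192 * (real T)\<^sup>2 / (real W)\<^sup>2 * (d1\<^sup>2 + d2\<^sup>2 + d3\<^sup>2))"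

text \<open>The deficit and the event that the window is too small are replaced by squares of
  centered sums, so that variances alone determine the expected cost.\<close>

lemma OPT_ge:
  assumes "0 \<le> \<alpha>" "0 \<le> \<gamma>" and T: "1 \<le> T" and W: "1 \<le> W" "W \<le> T" and r: "1 / 2 \<le> r" "r \<le> 5 / 8"
    and a: "\<And>t. t \<in> {1..T} \<Longrightarrow> a t \<in> {low_case, high_case}"
  defines "n \<equiv> (\<Sum>t=1..T. is_high (a t))"
  shows "1 / 10 * (real T / 2) + 6 / 10 * min (real T / 2) n - \<gamma> / real T * comparator_cost T W r a s
    \<le> OPT 1 T (\<lambda>_. 1 / 2 * real T) \<alpha> \<gamma> a s"
proof -
  define d1 where "d1 = (\<Sum>t\<in>{1..T}. r - of_bool (s (t, 1)))"
  define d2 where "d2 = (\<Sum>t\<in>{T-W<..T}. is_high (a t) - 1 / 4)"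
  define d3 where "d3 = (\<Sum>t\<in>{T-W<..T}. r - of_bool (s (t, 1)))"
  define D where "D = max 0 (real T / 2 - (\<Sum>t=1..T. of_bool (s (t, 1))))"
  define G where "G = real W - (\<Sum>t\<in>{T-W<..T}. is_high (a t)) - (\<Sum>t\<in>{T-W<..T}. of_bool (s (t, 1)))"
  obtain x where x: "\<And>t. 0 \<le> x t" "\<And>t. x t \<le> 1" and xs: "(\<Sum>t=1..T. x t) = real T / 2"
    and hx: "(\<Sum>t=1..T. is_high (a t) * x t) = min (real T / 2) n"
    and bx: "(\<Sum>t=1..T. backlog (single_alloc x) s t 1)
       \<le> (\<Sum>t=1..T. backlog (single_alloc (\<lambda>t. is_high (a t))) s t 1) + real W * D + (if G < D then real T * D else 0)"
    using comparator_alloc[of "\<lambda>t. is_high (a t)" "real T / 2" T W s] is_high_01 W(2)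
    unfolding D_def G_def n_def by auto
  have card: "card {T-W<..T} = W" using W by simp
  have rT: "real T / 2 \<le> r * real T" using r by (simp add: mult_right_mono[of "1 / 2" r "real T", simplified])
  have d1: "d1 = r * real T - (\<Sum>t=1..T. of_bool (s (t, 1)))" by (simp add: d1_def sum_subtractf)
  then have D: "0 \<le> D" "D \<le> \<bar>d1\<bar>" using rT by (auto simp: D_def)
  have "0 \<le> (\<Sum>t=1..T. of_bool (s (t, 1)) :: real)" by (intro sum_nonneg) auto
  then have DT: "D \<le> real T" by (simp add: D_def)
  have "real W * D \<le> real W * ((d1\<^sup>2 / sqrt (real T) + sqrt (real T)) / 2)"
  proof (rule mult_left_mono)
    have sT: "0 < sqrt (real T)" using T by simp
    \<comment> \<open>AM-GM on the scale sqrt T, the order of the standard deviation of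
      \<open>d1\<close>.\<close>
    have "0 \<le> (\<bar>d1\<bar> - sqrt (real T))\<^sup>2" by simp
    then have "2 * \<bar>d1\<bar> * sqrt (real T) \<le> d1\<^sup>2 + sqrt (real T) * sqrt (real T)"
      by (simp add: power2_diff)
    then have "2 * \<bar>d1\<bar> \<le> (d1\<^sup>2 + sqrt (real T) * sqrt (real T)) / sqrt (real T)"
      using sT by (simp only: pos_le_divide_eq)
    also have "\<dots> = d1\<^sup>2 / sqrt (real T) + sqrt (real T)"
      using sT by (simp add: add_divide_distrib real_div_sqrt)
    finally show "D \<le> (d1\<^sup>2 / sqrt (real T) + sqrt (real T)) / 2" using D by simp
  qed simp
  moreover have "(if G < D then real T * D else 0) \<le> 192 * (real T)\<^sup>2 / (real W)\<^sup>2 * (d1\<^sup>2 + d2\<^sup>2 + d3\<^sup>2)"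
  proof (cases "G < D")
    case True
    \<comment> \<open>A pathwise Chebyshev bound: as 3 / 4 - r \<ge> 1 / 8, the event
      \<open>G < D\<close> forces deviations of total size \<open>W / 8\<close>. The constant 192 is
      3 * 64, with 3 from the square of a sum of three terms.\<close>
    have "G = real W * (3 / 4 - r) - d2 + d3"
      using card by (simp add: G_def d2_def d3_def sum_subtractf algebra_simps)
    moreover have "real W * (1 / 8) \<le> real W * (3 / 4 - r)" using r by (intro mult_left_mono) auto
    ultimately have "real W / 8 \<le> \<bar>d1\<bar> + \<bar>d2\<bar> + \<bar>d3\<bar>" using True D by linarith
    then have "(real W / 8)\<^sup>2 \<le> (\<bar>d1\<bar> + \<bar>d2\<bar> + \<bar>d3\<bar>)\<^sup>2" by (intro power_mono) auto
    also have "\<dots> \<le> 3 * (d1\<^sup>2 + d2\<^sup>2 + d3\<^sup>2)"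
    proof -
      have "0 \<le> (\<bar>d1\<bar> - \<bar>d2\<bar>)\<^sup>2 + (\<bar>d2\<bar> - \<bar>d3\<bar>)\<^sup>2 + (\<bar>d1\<bar> - \<bar>d3\<bar>)\<^sup>2" by simp
      then show ?thesis by (simp add: power2_eq_square algebra_simps)
    qed
    finally have "(real W)\<^sup>2 \<le> 192 * (d1\<^sup>2 + d2\<^sup>2 + d3\<^sup>2)" by (simp add: power_divide)
    then have 1: "1 \<le> 192 * (d1\<^sup>2 + d2\<^sup>2 + d3\<^sup>2) / (real W)\<^sup>2" using W by simp
    have "real T * D \<le> (real T)\<^sup>2 * 1" using DT by (simp add: power2_eq_square mult_left_mono)
    also have "\<dots> \<le> (real T)\<^sup>2 * (192 * (d1\<^sup>2 + d2\<^sup>2 + d3\<^sup>2) / (real W)\<^sup>2)" using 1 by (intro mult_left_mono) auto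
    finally show ?thesis using True by (simp add: mult_ac)
  qed simp
  ultimately have "(\<Sum>t=1..T. backlog (single_alloc x) s t 1) \<le> comparator_cost T W r a s"
    using bx unfolding comparator_cost_def Let_def d1_def[symmetric] d2_def[symmetric] d3_def[symmetric] high_queue_def
    by linarith
  then have "\<gamma> / real T * (\<Sum>t=1..T. backlog (single_alloc x) s t 1) \<le> \<gamma> / real T * comparator_cost T W r a s"
    using assms(2) by (intro mult_left_mono) auto
  moreover have "(\<Sum>t=1..T. fst (a t) 1 * x t) = (\<Sum>t=1..T. 1 / 10 * x t + 6 / 10 * (is_high (a t) * x t))"
  proof (intro sum.cong refl)
    fix t assume "t \<in> {1..T}"
    from a[OF this] show "fst (a t) 1 * x t = 1 / 10 * x t + 6 / 10 * (is_high (a t) * x t)"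
      by (auto simp: low_case_def high_case_def is_high_def)
  qed
  then have "(\<Sum>t=1..T. fst (a t) 1 * x t) = 1 / 10 * (real T / 2) + 6 / 10 * min (real T / 2) n"
    by (simp only: sum.distrib sum_distrib_left[symmetric] xs hx)
  ultimately show ?thesis
    using OPT_ge_backlog[of \<alpha> \<gamma> "\<lambda>_. 1 / 2 * real T" T a x s] assms(1,2) a x xs by simp
qed

lemma expected_comparator_cost:
  assumes T: "1 \<le> T" and W: "1 \<le> W" "W \<le> T" and r: "1 / 2 \<le> r" "r \<le> 1"
  shows "(\<integral>\<omega>. comparator_cost T W r (fst \<omega>) (snd \<omega>) \<partial>(arrival_paths T \<Otimes>\<^sub>M services T r))
    \<le> 3 * real T + real W * sqrt (real T) + 192 * (real T) ^ 3 / (real W)\<^sup>2"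
proof -
  let ?P = "arrival_paths T \<Otimes>\<^sub>M services T r"
  have fin: "finite_prob_space ?P" by (intro finite_prob_space_pair) auto
  have fin2: "finite_prob_space (arrival_paths T)" "finite_prob_space (services T r)" by simp_all
  note [simp] = finite_prob_space_integrable[OF fin] measure_space_1[OF fin]
    measure_space_1[OF fin2(1)] measure_space_1[OF fin2(2)]
  define d1 where "d1 s = (\<Sum>t\<in>{1..T}. r - of_bool (s (t, 1)))" for s :: "nat \<times> nat \<Rightarrow> bool"
  define d2 where "d2 a = (\<Sum>t\<in>{T-W<..T}. is_high (a t) - 1 / 4)" for a
  define d3 where "d3 s = (\<Sum>t\<in>{T-W<..T}. r - of_bool (s (t, 1)))" for s :: "nat \<times> nat \<Rightarrow> bool"
  have fst: "(\<integral>\<omega>. f (fst \<omega>) \<partial>?P) = (\<integral>a. f a \<partial>arrival_paths T)" for f :: "_ \<Rightarrow> real"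
    using finite_prob_space_integral_pair(1)[OF fin2, of "\<lambda>\<omega>. f (fst \<omega>)"] by simp
  have snd: "(\<integral>\<omega>. f (snd \<omega>) \<partial>?P) = (\<integral>s. f s \<partial>services T r)" for f :: "_ \<Rightarrow> real"
    using finite_prob_space_integral_pair(2)[OF fin2, of "\<lambda>\<omega>. f (snd \<omega>)"] by simp
  have v: "r * (1 - r) \<le> 1 / 4"
    using zero_le_power2[of "r - 1 / 2"] by (simp add: power2_eq_square algebra_simps)
  have W': "card {T-W<..T} = W" "{T-W<..T} \<subseteq> {1..T}" using W by auto
  have e1: "(\<integral>\<omega>. (d1 (snd \<omega>))\<^sup>2 \<partial>?P) \<le> real T * (1 / 4)"
  proof -
    have "(\<integral>\<omega>. (d1 (snd \<omega>))\<^sup>2 \<partial>?P) = real T * (r * (1 - r))"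
      unfolding snd[of "\<lambda>s. (d1 s)\<^sup>2"] unfolding d1_def using r by (subst service_moments(2)) auto
    then show ?thesis using mult_left_mono[OF v, of "real T"] by simp
  qed
  have e3: "(\<integral>\<omega>. (d3 (snd \<omega>))\<^sup>2 \<partial>?P) \<le> real T * (1 / 4)"
  proof -
    have "(\<integral>\<omega>. (d3 (snd \<omega>))\<^sup>2 \<partial>?P) = real W * (r * (1 - r))"
      unfolding snd[of "\<lambda>s. (d3 s)\<^sup>2"] unfolding d3_def using W' r by (subst service_moments(2)) auto
    also have "\<dots> \<le> real T * (1 / 4)" using v W r by (intro mult_mono) auto
    finally show ?thesis .
  qed
  have e2: "(\<integral>\<omega>. (d2 (fst \<omega>))\<^sup>2 \<partial>?P) \<le> real T * (1 / 4)"
  proof -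
    have "(\<integral>\<omega>. (d2 (fst \<omega>))\<^sup>2 \<partial>?P) = real W * (3 / 16)"
      unfolding fst[of "\<lambda>a. (d2 a)\<^sup>2"] unfolding d2_def using W' by (subst arrival_variance) auto
    also have "\<dots> \<le> real T * (1 / 4)" using W by (intro mult_mono) auto
    finally show ?thesis .
  qed
  define q where "q = (\<integral>\<omega>. (\<Sum>t=1..T. high_queue (fst \<omega>) (snd \<omega>) t) \<partial>?P)"
  have "(\<integral>\<omega>. comparator_cost T W r (fst \<omega>) (snd \<omega>) \<partial>?P) =
    (\<integral>\<omega>. (\<Sum>t=1..T. high_queue (fst \<omega>) (snd \<omega>) t)
      + (real W / 2 / sqrt (real T) * (d1 (snd \<omega>))\<^sup>2 + real W / 2 * sqrt (real T))
      + 192 * (real T)\<^sup>2 / (real W)\<^sup>2 * ((d1 (snd \<omega>))\<^sup>2 + (d2 (fst \<omega>))\<^sup>2 + (d3 (snd \<omega>))\<^sup>2) \<partial>?P)"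
    unfolding comparator_cost_def Let_def d1_def d2_def d3_def
    by (intro Bochner_Integration.integral_cong refl) (simp add: field_simps)
  also have "\<dots> = q
      + (real W / 2 / sqrt (real T) * (\<integral>\<omega>. (d1 (snd \<omega>))\<^sup>2 \<partial>?P) + real W / 2 * sqrt (real T))
      + 192 * (real T)\<^sup>2 / (real W)\<^sup>2 *
        ((\<integral>\<omega>. (d1 (snd \<omega>))\<^sup>2 \<partial>?P) + (\<integral>\<omega>. (d2 (fst \<omega>))\<^sup>2 \<partial>?P) + (\<integral>\<omega>. (d3 (snd \<omega>))\<^sup>2 \<partial>?P))"
    unfolding q_def by simp
  also have "\<dots> \<le> 3 * real T + (real W / 2 / sqrt (real T) * real T + real W / 2 * sqrt (real T))
      + 192 * (real T)\<^sup>2 / (real W)\<^sup>2 * real T"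
    using expected_high_queue[OF r, of T] e1 e2 e3 unfolding q_def
    by (intro add_mono mult_left_mono) (auto intro: order_trans)
  also have "\<dots> = 3 * real T + real W * sqrt (real T) + 192 * (real T) ^ 3 / (real W)\<^sup>2"
  proof -
    have "real W / 2 / sqrt (real T) * real T = real W / 2 * (real T / sqrt (real T))" by simp
    also have "real T / sqrt (real T) = sqrt (real T)" by (simp add: real_div_sqrt)
    finally have "real W / 2 / sqrt (real T) * real T = real W / 2 * sqrt (real T)" .
    then show ?thesis unfolding \<open>real W / 2 / sqrt (real T) * real T = real W / 2 * sqrt (real T)\<close>
      by (simp add: power3_eq_cube power2_eq_square)
  qed
  finally show ?thesis .
qed

section \<open>The regret\<close>

text \<open>The backlog dominates the positive part of the surplus, less the slack drift, plus the
  centered services. From the 1 / 128 of \<open>positive_part_moment\<close>, the expected surplus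
  and the slack each take 1 / 512 and leave 1 / 256.\<close>

lemma expected_backlog:
  assumes k: "0 < k" "0 \<le> \<alpha>" and \<sigma>: "argmax_rule 1 \<sigma>"
  obtains T0 where "\<And>T \<epsilon>. T0 \<le> T \<Longrightarrow> 0 \<le> \<epsilon> \<Longrightarrow> \<epsilon> \<le> 1 / 512 / sqrt (real T) \<Longrightarrow>
    real T * sqrt (real T) / 800 \<le>
      (\<integral>\<omega>. (\<Sum>t=1..T. backlog (half_alloc T k \<alpha> \<sigma> (fst \<omega>)) (snd \<omega>) t 1)
        \<partial>(arrival_paths T \<Otimes>\<^sub>M services T (1 / 2 + \<epsilon>)))"
proof -
  obtain N0 where N0: "\<And>N T. N0 \<le> N \<Longrightarrow> N \<le> T \<Longrightarrow> - (1 / 512) * sqrt (real N) \<le>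
      (\<integral>a. (\<Sum>t=1..N. half_alloc T k \<alpha> \<sigma> a t 1 - 1 / 2) \<partial>arrival_paths T)"
    by (rule expected_surplus[OF k \<sigma>]) blast
  show thesis
  proof (rule that)
    fix T \<epsilon> assume T: "2 * N0 + 2 \<le> T" and \<epsilon>: "0 \<le> \<epsilon>" "\<epsilon> \<le> 1 / 512 / sqrt (real T)"
    define r where "r = 1 / 2 + \<epsilon>"
    let ?P = "arrival_paths T \<Otimes>\<^sub>M services T r" and ?z = "half_alloc T k \<alpha> \<sigma>"
    have fin2: "finite_prob_space (arrival_paths T)" "finite_prob_space (services T r)" by simp_all
    have fin: "finite_prob_space ?P" by (intro finite_prob_space_pair) auto
    note [simp] = finite_prob_space_integrable[OF fin]
    have sT: "0 < sqrt (real T)" using T by simp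
    have "1 / 512 / sqrt (real T) \<le> 1 / 512 / 1" using T by (intro divide_left_mono) auto
    then have r: "1 / 2 \<le> r" "r \<le> 3 / 4" using \<epsilon> by (auto simp: r_def)
    have each: "sqrt (real t) / 256 \<le> (\<integral>\<omega>. backlog (?z (fst \<omega>)) (snd \<omega>) t 1 \<partial>?P)"
      if t: "N0 \<le> t" "1 \<le> t" "t \<le> T" for t
    proof -
      define A where "A a = (\<Sum>\<tau>=1..t. ?z a \<tau> 1 - 1 / 2) - \<epsilon> * real t" for a
      define N where "N s = (\<Sum>\<tau>\<in>{1..t}. r - of_bool (s (\<tau>, 1)))" for s :: "nat \<times> nat \<Rightarrow> bool"
      have sub: "{1..t} \<subseteq> {1..T}" using t by auto
      have r1: "0 \<le> r" "r \<le> 1" using r by auto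
      have "3 / 16 \<le> r * (1 - r)"
      proof -
        have "0 \<le> (r - 1 / 4) * (3 / 4 - r)" using r by (intro mult_nonneg_nonneg) auto
        also have "\<dots> = r * (1 - r) - 3 / 16" by (simp add: field_simps)
        finally show ?thesis by simp
      qed
      then have "real t * (3 / 16) \<le> real t * (r * (1 - r))" by (intro mult_left_mono) auto
      then have N: "sqrt (real t) / 128 \<le> (\<integral>s. max 0 (N s) \<partial>services T r)"
        using service_moments[OF sub r1] t
        by (intro positive_part_moment fin2) (simp_all add: N_def)
      have "\<epsilon> * real t \<le> 1 / 512 / sqrt (real T) * real t" using \<epsilon> by (intro mult_right_mono) auto
      also have "\<dots> = 1 / 512 * (sqrt (real t) * (sqrt (real t) / sqrt (real T)))" by simp
      also have "\<dots> \<le> 1 / 512 * (sqrt (real t) * 1)"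
        using t sT by (intro mult_left_mono) (auto simp: divide_le_eq_1)
      finally have "\<epsilon> * real t \<le> sqrt (real t) / 512" by simp
      moreover have "(\<integral>a. A a \<partial>arrival_paths T) =
        (\<integral>a. (\<Sum>\<tau>=1..t. ?z a \<tau> 1 - 1 / 2) \<partial>arrival_paths T) - \<epsilon> * real t"
        unfolding A_def using finite_prob_space_integrable[OF fin2(1)] measure_space_1[OF fin2(1)]
        by (subst Bochner_Integration.integral_diff) auto
      ultimately have "- (sqrt (real t) / 256) \<le> (\<integral>a. A a \<partial>arrival_paths T)"
        using N0[OF t(1,3)] by linarith
      then have "(\<integral>s. max 0 (N s) \<partial>services T r) - sqrt (real t) / 256
        \<le> (\<integral>\<omega>. max 0 (A (fst \<omega>) + N (snd \<omega>)) \<partial>?P)"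
        by (intro positive_part_independent fin2) auto
      also have "\<dots> \<le> (\<integral>\<omega>. backlog (?z (fst \<omega>)) (snd \<omega>) t 1 \<partial>?P)"
      proof (rule integral_mono)
        fix \<omega> :: "(nat \<Rightarrow> case_type) \<times> (nat \<times> nat \<Rightarrow> bool)"
        have "A (fst \<omega>) + N (snd \<omega>) = (\<Sum>\<tau>=1..t. ?z (fst \<omega>) \<tau> 1 - of_bool (snd \<omega> (\<tau>, 1)))"
          by (simp add: A_def N_def r_def sum_subtractf algebra_simps)
        also have "\<dots> \<le> backlog (?z (fst \<omega>)) (snd \<omega>) t 1" by (rule backlog_ge_sum)
        finally show "max 0 (A (fst \<omega>) + N (snd \<omega>)) \<le> backlog (?z (fst \<omega>)) (snd \<omega>) t 1" by simp
      qed auto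
      finally show ?thesis using N by linarith
    qed
    \<comment> \<open>Only the second half of the horizon is counted, with 7 / 10 in place of sqrt
      (1 / 2); (1 / 2) * (7 / 10) / 256 exceeds 1 / 800.\<close>
    have late: "7 / 10 * sqrt (real T) / 256 \<le> (\<integral>\<omega>. backlog (?z (fst \<omega>)) (snd \<omega>) t 1 \<partial>?P)"
      if t: "t \<in> {T div 2<..T}" for t
    proof -
      have "sqrt (49 / 100 * real T) \<le> sqrt (real t)"
        using t by (intro real_sqrt_le_mono) auto
      then have "7 / 10 * sqrt (real T) \<le> sqrt (real t)"
        by (simp add: real_sqrt_mult real_sqrt_divide)
      then have "7 / 10 * sqrt (real T) / 256 \<le> sqrt (real t) / 256" by (intro divide_right_mono) auto
      also have "\<dots> \<le> (\<integral>\<omega>. backlog (?z (fst \<omega>)) (snd \<omega>) t 1 \<partial>?P)"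
        using t T by (intro each) auto
      finally show ?thesis .
    qed
    have "real T * sqrt (real T) / 800 \<le> real T / 2 * (7 / 10 * sqrt (real T) / 256)" by simp
    also have "\<dots> \<le> real (card {T div 2<..T}) * (7 / 10 * sqrt (real T) / 256)"
      by (intro mult_right_mono) auto
    also have "\<dots> = (\<Sum>t\<in>{T div 2<..T}. 7 / 10 * sqrt (real T) / 256)" by simp
    also have "\<dots> \<le> (\<Sum>t\<in>{T div 2<..T}. (\<integral>\<omega>. backlog (?z (fst \<omega>)) (snd \<omega>) t 1 \<partial>?P))"
      using late by (rule sum_mono)
    also have "\<dots> \<le> (\<Sum>t=1..T. (\<integral>\<omega>. backlog (?z (fst \<omega>)) (snd \<omega>) t 1 \<partial>?P))"
      by (intro sum_mono2 Bochner_Integration.integral_nonneg) auto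
    also have "\<dots> = (\<integral>\<omega>. (\<Sum>t=1..T. backlog (?z (fst \<omega>)) (snd \<omega>) t 1) \<partial>?P)"
      by (rule Bochner_Integration.integral_sum[symmetric]) simp
    finally show "real T * sqrt (real T) / 800 \<le>
      (\<integral>\<omega>. (\<Sum>t=1..T. backlog (half_alloc T k \<alpha> \<sigma> (fst \<omega>)) (snd \<omega>) t 1)
        \<partial>(arrival_paths T \<Otimes>\<^sub>M services T (1 / 2 + \<epsilon>)))"
      unfolding r_def .
  qed
qed

text \<open>The pathwise difference splits into a reward part \<open>R\<close> free of \<gamma> and
  a backlog part with factor \<gamma>. The mean of \<open>R\<close> is 1 / 20 - 42 / 10 / T,
  nonnegative from T = 84 on, so the bound is exactly proportional to \<gamma>.\<close>

lemma regret_ge: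
  assumes k: "0 < k" "0 \<le> \<alpha>" and \<sigma>: "argmax_rule 1 \<sigma>" and "0 \<le> \<gamma>"
    and T: "84 \<le> T" and W: "1 \<le> W" "W \<le> T" and \<epsilon>: "0 \<le> \<epsilon>" "\<epsilon> \<le> 1 / 8"
  shows "\<gamma> / real T * ((\<integral>\<omega>. (\<Sum>t=1..T. backlog (half_alloc T k \<alpha> \<sigma> (fst \<omega>)) (snd \<omega>) t 1)
        \<partial>(arrival_paths T \<Otimes>\<^sub>M services T (1 / 2 + \<epsilon>)))
      - (3 * real T + real W * sqrt (real T) + 192 * (real T) ^ 3 / (real W)\<^sup>2))
    \<le> regret_codl 1 arrivals (\<lambda>_. 1 / 2) (\<lambda>_. 1 / 2 + \<epsilon>) T k \<sigma> \<alpha> \<gamma>"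
proof -
  define r where "r = 1 / 2 + \<epsilon>"
  have r: "1 / 2 \<le> r" "r \<le> 5 / 8" "r \<le> 1" using \<epsilon> by (auto simp: r_def)
  have T1: "1 \<le> T" using T by simp
  let ?P = "arrival_paths T \<Otimes>\<^sub>M services T r"
  have fin2: "finite_prob_space (arrival_paths T)" "finite_prob_space (services T r)" by simp_all
  have fin: "finite_prob_space ?P" by (intro finite_prob_space_pair) auto
  note [simp] = finite_prob_space_integrable[OF fin] measure_space_1[OF fin]
    finite_prob_space_integrable[OF fin2(1)] measure_space_1[OF fin2(1)] measure_space_1[OF fin2(2)]
  have fst: "(\<integral>\<omega>. f (fst \<omega>) \<partial>?P) = (\<integral>a. f a \<partial>arrival_paths T)" for f :: "_ \<Rightarrow> real"
    using finite_prob_space_integral_pair(1)[OF fin2, of "\<lambda>\<omega>. f (fst \<omega>)"] by simp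
  define N where "N a = (\<Sum>t\<in>{1..T}. is_high (a t) - 1 / 4)" for a
  \<comment> \<open>The last term is a Chebyshev penalty for paths with more than T / 2 high cases:
    there it is at least 14 / 10, while the first two terms may be too large by 12 / 10.\<close>
  define R where "R a = 6 / 10 * is_high (a 1) - 1 / 10 - 14 / 10 * (16 / (real T)\<^sup>2 * (N a)\<^sup>2)" for a
  define B where "B \<omega> = (\<Sum>t=1..T. backlog (half_alloc T k \<alpha> \<sigma> (fst \<omega>)) (snd \<omega>) t 1)"
    for \<omega> :: "(nat \<Rightarrow> case_type) \<times> (nat \<times> nat \<Rightarrow> bool)"
  define K where "K \<omega> = comparator_cost T W r (fst \<omega>) (snd \<omega>)" for \<omega>
  have pointwise: "R (fst \<omega>) + \<gamma> / real T * (B \<omega> - K \<omega>) \<le>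
    OPT 1 T (\<lambda>i. 1 / 2 * real T) \<alpha> \<gamma> (fst \<omega>) (snd \<omega>) - ALG_codl 1 T (\<lambda>_. 1 / 2) k \<sigma> \<alpha> \<gamma> (fst \<omega>) (snd \<omega>)"
    if "\<omega> \<in> space ?P" for \<omega>
  proof -
    obtain a s where \<omega>: "\<omega> = (a, s)" by (cases \<omega>)
    have "a \<in> space (arrival_paths T)" using that by (simp add: \<omega> space_pair_measure)
    then have a: "a t \<in> {low_case, high_case}" if "t \<in> {1..T}" for t
      using space_arrival_paths that by blast
    define n where "n = (\<Sum>t=1..T. is_high (a t))"
    have n: "N a = n - real T / 4" by (simp add: N_def n_def sum_subtractf)
    have h: "0 \<le> is_high (a 1)" "is_high (a 1) \<le> 1" using is_high_01[of "a 1"] by auto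
    define X where "X = 16 / (real T)\<^sup>2 * (N a)\<^sup>2"
    have Ra: "R a = 6 / 10 * is_high (a 1) - 1 / 10 - 14 / 10 * X" by (simp add: R_def X_def)
    have "R a \<le> - 1 / 10 + 6 / 10 * min (real T / 2) n - 6 / 10 * min (real T / 2 + 1) (n - is_high (a 1))"
    proof (cases "n \<le> real T / 2")
      case True
      have "0 \<le> X" by (simp add: X_def)
      have *: "min (real T / 2) n = n" "min (real T / 2 + 1) (n - is_high (a 1)) = n - is_high (a 1)"
        using True h by (auto simp: min_def)
      show ?thesis unfolding Ra * using \<open>0 \<le> X\<close> by (simp add: right_diff_distrib)
    next
      case False
      then have "real T / 4 \<le> N a" using n by simp
      then have "(real T / 4)\<^sup>2 \<le> (N a)\<^sup>2" by (intro power_mono) auto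
      then have "(real T)\<^sup>2 \<le> 16 * (N a)\<^sup>2" by (simp add: power_divide)
      then have "1 \<le> X" using T by (simp add: X_def le_divide_eq)
      moreover have *: "min (real T / 2) n = real T / 2" using False by (auto simp: min_def)
      define M where "M = min (real T / 2 + 1) (n - is_high (a 1))"
      have "M \<le> real T / 2 + 1" by (simp add: M_def)
      ultimately show ?thesis unfolding Ra * M_def[symmetric] using h by simp
    qed
    moreover have "1 / 10 * (real T / 2) + 6 / 10 * min (real T / 2) n - \<gamma> / real T * K \<omega>
      \<le> OPT 1 T (\<lambda>_. 1 / 2 * real T) \<alpha> \<gamma> a s"
      unfolding n_def K_def \<omega> fst_conv snd_conv
      using assms(2,4) T1 W r(1,2) a by (intro OPT_ge) auto
    moreover have "ALG_codl 1 T (\<lambda>_. 1 / 2) k \<sigma> \<alpha> \<gamma> a s + \<gamma> / real T * B \<omega>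
      \<le> 1 / 10 * (real T / 2 + 1) + 6 / 10 * min (real T / 2 + 1) (n - is_high (a 1))"
      unfolding n_def B_def \<omega> fst_conv snd_conv
      using T1 a by (intro ALG_codl_le k \<sigma>) auto
    moreover have "1 / 10 * (real T / 2 + 1) = 1 / 10 * (real T / 2) + 1 / 10" by simp
    ultimately show ?thesis unfolding \<omega> fst_conv snd_conv right_diff_distrib by linarith
  qed
  have h1: "(\<integral>a. is_high (a 1) \<partial>arrival_paths T) = 1 / 4"
    using arrival_centered[of 1 T "\<lambda>_. 1"] T1 by simp
  have N2: "(\<integral>a. (N a)\<^sup>2 \<partial>arrival_paths T) = real T * (3 / 16)"
    unfolding N_def by (subst arrival_variance) auto
  have "(\<integral>a. R a \<partial>arrival_paths T) = 6 / 10 * (\<integral>a. is_high (a 1) \<partial>arrival_paths T) - 1 / 10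
    - 14 / 10 * (16 / (real T)\<^sup>2 * (\<integral>a. (N a)\<^sup>2 \<partial>arrival_paths T))"
    by (simp add: R_def)
  also have "\<dots> = 6 / 10 * (1 / 4) - 1 / 10 - 14 / 10 * (16 / (real T)\<^sup>2 * (real T * (3 / 16)))"
    unfolding h1 N2 ..
  also have "\<dots> = 1 / 20 - 42 / 10 / real T" using T by (simp add: power2_eq_square)
  finally have "(\<integral>a. R a \<partial>arrival_paths T) = 1 / 20 - 42 / 10 / real T" .
  moreover have "42 / 10 / real T \<le> 42 / 10 / 84" using T by (intro divide_left_mono) auto
  ultimately have R: "0 \<le> (\<integral>a. R a \<partial>arrival_paths T)" by simp
  have K: "(\<integral>\<omega>. K \<omega> \<partial>?P) \<le> 3 * real T + real W * sqrt (real T) + 192 * (real T) ^ 3 / (real W)\<^sup>2"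
    unfolding K_def by (rule expected_comparator_cost[OF T1 W r(1,3)])
  have "\<gamma> / real T * ((\<integral>\<omega>. B \<omega> \<partial>?P) - (3 * real T + real W * sqrt (real T) + 192 * (real T) ^ 3 / (real W)\<^sup>2))
    \<le> (\<integral>a. R a \<partial>arrival_paths T) + \<gamma> / real T * ((\<integral>\<omega>. B \<omega> \<partial>?P) - (\<integral>\<omega>. K \<omega> \<partial>?P))"
    using R K \<open>0 \<le> \<gamma>\<close> by (intro add_increasing mult_left_mono) auto
  also have "\<dots> = (\<integral>\<omega>. R (fst \<omega>) + \<gamma> / real T * (B \<omega> - K \<omega>) \<partial>?P)"
    using fst[of R] by simp
  also have "\<dots> \<le> regret_codl 1 arrivals (\<lambda>_. 1 / 2) (\<lambda>_. r) T k \<sigma> \<alpha> \<gamma>"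
    unfolding regret_codl_def sample_space_eq using pointwise by (intro integral_mono) auto
  finally show ?thesis unfolding B_def r_def .
qed

theorem theorem4p2:
  "\<exists>(q::real) (m::nat) (F::case_type measure) (\<rho>::nat \<Rightarrow> real).
     q > 0 \<and> valid_arrivals m F \<rho> \<and>
     (\<forall>(k::real) (\<alpha>::real) \<sigma>. k > 0 \<longrightarrow> \<alpha> \<ge> 0 \<longrightarrow> argmax_rule m \<sigma> \<longrightarrow>
       (\<exists>(C::real) (T0::nat). C > 0 \<and> T0 \<ge> 1 \<and>
         (\<forall>(T::nat) (\<gamma>::real) (\<epsilon>::real).
            T \<ge> T0 \<longrightarrow> \<gamma> \<ge> 0 \<longrightarrow> 0 \<le> \<epsilon> \<longrightarrow> \<epsilon> \<le> q / sqrt (real T) \<longrightarrow>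
            (\<forall>i\<in>{1..m}. 0 < \<rho> i + \<epsilon> \<and> \<rho> i + \<epsilon> < 1) \<and>
            regret_codl m F \<rho> (\<lambda>i. \<rho> i + \<epsilon>) T k \<sigma> \<alpha> \<gamma> \<ge> C * \<gamma> * sqrt (real T))))"
proof (rule exI[of _ "1 / 512"], rule exI[of _ 1], rule exI[of _ arrivals], rule exI[of _ "\<lambda>_. 1 / 2"],
    intro conjI allI impI)
  show "0 < (1 / 512 :: real)" by simp
  show "valid_arrivals 1 arrivals (\<lambda>_. 1 / 2)" by (rule valid_arrivals_instance)
  fix k \<alpha> :: real and \<sigma> :: "nat \<Rightarrow> (nat \<Rightarrow> real) \<Rightarrow> nat \<Rightarrow> real"
  assume k: "0 < k" "0 \<le> \<alpha>" and \<sigma>: "argmax_rule 1 \<sigma>"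
  obtain T1 where T1: "\<And>T \<epsilon>. T1 \<le> T \<Longrightarrow> 0 \<le> \<epsilon> \<Longrightarrow> \<epsilon> \<le> 1 / 512 / sqrt (real T) \<Longrightarrow>
    real T * sqrt (real T) / 800 \<le>
      (\<integral>\<omega>. (\<Sum>t=1..T. backlog (half_alloc T k \<alpha> \<sigma> (fst \<omega>)) (snd \<omega>) t 1)
        \<partial>(arrival_paths T \<Otimes>\<^sub>M services T (1 / 2 + \<epsilon>)))"
    by (rule expected_backlog[OF k \<sigma>]) blast
  have "eventually (\<lambda>T. 3 * real T + 192 * 6400\<^sup>2 * real T \<le> real T * sqrt (real T) / 1600) sequentially"
    by real_asymp
  then obtain T2 where T2: "\<And>T. T2 \<le> T \<Longrightarrow> 3 * real T + 192 * 6400\<^sup>2 * real T \<le> real T * sqrt (real T) / 1600"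
    by (auto simp: eventually_sequentially)
  show "\<exists>C T0. 0 < C \<and> 1 \<le> T0 \<and>
    (\<forall>T \<gamma> \<epsilon>. T0 \<le> T \<longrightarrow> 0 \<le> \<gamma> \<longrightarrow> 0 \<le> \<epsilon> \<longrightarrow> \<epsilon> \<le> 1 / 512 / sqrt (real T) \<longrightarrow>
      (\<forall>i\<in>{1..1}. 0 < 1 / 2 + \<epsilon> \<and> 1 / 2 + \<epsilon> < 1) \<and>
      C * \<gamma> * sqrt (real T) \<le> regret_codl 1 arrivals (\<lambda>_. 1 / 2) (\<lambda>_. 1 / 2 + \<epsilon>) T k \<sigma> \<alpha> \<gamma>)"
  \<comment> \<open>Here 1 / 3200 = 1 / 800 - 1 / 3200 - 1 / 1600: the backlog of CO-DL, less the
    window and the terms linear in \<open>T\<close>. The constant is universal; only the threshold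
    depends on \<open>k\<close>, \<alpha> and \<sigma>.\<close>
  proof (rule exI[of _ "1 / 3200"], rule exI[of _ "max 6400 (max T1 T2)"], intro conjI allI impI)
    fix T :: nat and \<gamma> \<epsilon> :: real
    assume T: "max 6400 (max T1 T2) \<le> T" and \<gamma>: "0 \<le> \<gamma>" and \<epsilon>: "0 \<le> \<epsilon>" "\<epsilon> \<le> 1 / 512 / sqrt (real T)"
    have "1 / 512 / sqrt (real T) \<le> 1 / 512 / 1" using T by (intro divide_left_mono) auto
    then have \<epsilon>': "\<epsilon> \<le> 1 / 8" using \<epsilon> by simp
    then show "\<forall>i\<in>{1..1}. 0 < 1 / 2 + \<epsilon> \<and> 1 / 2 + \<epsilon> < 1" using \<epsilon> by simp
    \<comment> \<open>With a window linear in \<open>T\<close>, its cost \<open>W * sqrt T\<close>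
      is a small multiple of \<open>T * sqrt T\<close>, while the fallback term T^3 / W^2 is only
      linear in \<open>T\<close>. Since W \<ge> 1, rounding down loses at most a factor 2.\<close>
    define W where "W = T div 3200"
    have W: "1 \<le> W" "W \<le> T" using T by (auto simp: W_def)
    have W_le: "real W \<le> real T / 3200"
    proof -
      have "3200 * W \<le> T" by (simp add: W_def)
      then have "real (3200 * W) \<le> real T" by (simp only: of_nat_le_iff)
      then show ?thesis by simp
    qed
    have "T < 3200 * W + 3200"
      using mult_div_mod_eq[of 3200 T] mod_less_divisor[of 3200 T] unfolding W_def by linarith
    then have "T \<le> 6400 * W" using W by linarith
    then have W_ge: "real T / 6400 \<le> real W" by simp
    have "(real T / 6400)\<^sup>2 \<le> (real W)\<^sup>2" using W_ge by (intro power_mono) auto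
    moreover have "0 < (real T / 6400)\<^sup>2" using T by simp
    ultimately have "192 * (real T) ^ 3 / (real W)\<^sup>2 \<le> 192 * (real T) ^ 3 / (real T / 6400)\<^sup>2"
      using W by (intro divide_left_mono) auto
    also have "\<dots> = 192 * 6400\<^sup>2 * real T" using T by (simp add: power3_eq_cube power2_eq_square)
    finally have "192 * (real T) ^ 3 / (real W)\<^sup>2 \<le> 192 * 6400\<^sup>2 * real T" .
    moreover have "real W * sqrt (real T) \<le> real T / 3200 * sqrt (real T)"
      using W_le by (intro mult_right_mono) auto
    then have "real W * sqrt (real T) \<le> real T * sqrt (real T) / 3200" by simp
    moreover have "3 * real T + 192 * 6400\<^sup>2 * real T \<le> real T * sqrt (real T) / 1600"
      using T by (intro T2) simp
    ultimately have "real T * sqrt (real T) / 3200 \<le> real T * sqrt (real T) / 800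
      - (3 * real T + real W * sqrt (real T) + 192 * (real T) ^ 3 / (real W)\<^sup>2)"
      by linarith
    also have "\<dots> \<le> (\<integral>\<omega>. (\<Sum>t=1..T. backlog (half_alloc T k \<alpha> \<sigma> (fst \<omega>)) (snd \<omega>) t 1)
        \<partial>(arrival_paths T \<Otimes>\<^sub>M services T (1 / 2 + \<epsilon>)))
      - (3 * real T + real W * sqrt (real T) + 192 * (real T) ^ 3 / (real W)\<^sup>2)"
      using T1[of T \<epsilon>] T \<epsilon> by (intro diff_right_mono) auto
    finally have "\<gamma> / real T * (real T * sqrt (real T) / 3200) \<le>
      \<gamma> / real T * ((\<integral>\<omega>. (\<Sum>t=1..T. backlog (half_alloc T k \<alpha> \<sigma> (fst \<omega>)) (snd \<omega>) t 1)
        \<partial>(arrival_paths T \<Otimes>\<^sub>M services T (1 / 2 + \<epsilon>)))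
      - (3 * real T + real W * sqrt (real T) + 192 * (real T) ^ 3 / (real W)\<^sup>2))"
      using \<gamma> by (intro mult_left_mono) auto
    also have "\<dots> \<le> regret_codl 1 arrivals (\<lambda>_. 1 / 2) (\<lambda>_. 1 / 2 + \<epsilon>) T k \<sigma> \<alpha> \<gamma>"
      using T W by (intro regret_ge k \<sigma> \<gamma> \<epsilon> \<epsilon>') auto
    finally show "1 / 3200 * \<gamma> * sqrt (real T) \<le> regret_codl 1 arrivals (\<lambda>_. 1 / 2) (\<lambda>_. 1 / 2 + \<epsilon>) T k \<sigma> \<alpha> \<gamma>"
      using T by simp
  qed auto
qed

end
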